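(* Let $G$ be a finitely generated infinite group. Suppose that for some symmetric probability measure $\mu$ on $G$ with finite generating support, $$\mu^{(2n)}(\mathrm{id})\gtrsim\exp(-n^{1/3}),$$ that is, there are constants $c_1,c_2\in(0,\infty)$ such that $\mu^{(2n)}(\mathrm{id})\ge c_1\exp\left(-(c_2n)^{1/3}\right)$ for all integers $n\ge1$. Then $(G,\eta)$ has the Liouville property for every symmetric probability measure $\eta$ on $G$ with finite first moment, $\sum_{g\in G}|g|\eta(g)<\infty$.
   Context: A probability measure $\mu$ on a (discrete) group $G$ is symmetric if $\mu(g)=\mu(g^{-1})$ for all $g\in G$; it has finite generating support if its support is a finite set that generates $G$. $\mu^{(n)}$ denotes the $n$-fold convolution power of $\mu$, $\mathrm{id}$ is the identity element, and $|g|$ is the word distance of $g$ from the identity with respect to a fixed finite generating set of $G$. A function $h:G\to\mathbb{R}$ is $\eta$-harmonic if $h(x)=\sum_{y\in G}h(xy)\eta(y)$ for all $x\in G$. The pair $(G,\eta)$ has the Liouville property if all bounded $\eta$-harmonic functions on $G$ are constant.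
   Formalization: The support of η is additionally assumed to generate G; without this the claim fails (e.g. η the point mass at id, for which every function is η-harmonic), and the Liouville property itself forces the support of η to generate G. *)

theory Defs
  imports "HOL-Algebra.Generated_Groups" "HOL-Probability.Probability_Mass_Function"
begin

text \<open>
  Throughout, a probability measure on a discrete group \<open>G\<close> is a \<open>pmf\<close> on the ambient type
  whose support is contained in \<open>carrier G\<close>.
\<close>

definition pmf_on_group :: "('a, 'b) monoid_scheme \<Rightarrow> 'a pmf \<Rightarrow> bool" where
  "pmf_on_group G \<mu> \<longleftrightarrow> set_pmf \<mu> \<subseteq> carrier G"

definition symmetric_pmf :: "('a, 'b) monoid_scheme \<Rightarrow> 'a pmf \<Rightarrow> bool" where
  "symmetric_pmf G \<mu> \<longleftrightarrow> (\<forall>g\<in>carrier G. pmf \<mu> g = pmf \<mu> (inv\<^bsub>G\<^esub> g))"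

definition generating_set :: "('a, 'b) monoid_scheme \<Rightarrow> 'a set \<Rightarrow> bool" where
  "generating_set G S \<longleftrightarrow> S \<subseteq> carrier G \<and> generate G S = carrier G"

definition convolution_pmf :: "('a, 'b) monoid_scheme \<Rightarrow> 'a pmf \<Rightarrow> 'a pmf \<Rightarrow> 'a pmf" where
  "convolution_pmf G \<mu> \<nu> = map_pmf (\<lambda>(x, y). x \<otimes>\<^bsub>G\<^esub> y) (pair_pmf \<mu> \<nu>)"

primrec convolution_power :: "('a, 'b) monoid_scheme \<Rightarrow> 'a pmf \<Rightarrow> nat \<Rightarrow> 'a pmf" where
  "convolution_power G \<mu> 0 = return_pmf \<one>\<^bsub>G\<^esub>"
| "convolution_power G \<mu> (Suc n) = convolution_pmf G (convolution_power G \<mu> n) \<mu>"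

text \<open>
  Words are in the letters of \<open>S\<close> and their inverses. The minimum exists for every group
  element whenever \<open>S\<close> generates \<open>G\<close>.
\<close>

definition word_length :: "('a, 'b) monoid_scheme \<Rightarrow> 'a set \<Rightarrow> 'a \<Rightarrow> nat" where
  "word_length G S g =
     (LEAST n. \<exists>ws. length ws = n \<and> set ws \<subseteq> S \<union> m_inv G ` S \<and>
                    foldr (\<lambda>x y. x \<otimes>\<^bsub>G\<^esub> y) ws \<one>\<^bsub>G\<^esub> = g)"

definition finite_first_moment :: "('a, 'b) monoid_scheme \<Rightarrow> 'a set \<Rightarrow> 'a pmf \<Rightarrow> bool" where
  "finite_first_moment G S \<eta> \<longleftrightarrow>
     (\<lambda>g. real (word_length G S g) * pmf \<eta> g) summable_on carrier G"

text \<open>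
  Stating harmonicity with \<open>has_sum\<close> makes convergence of the (unordered) sum part of the
  definition; for bounded \<open>h\<close> the sum always converges.
\<close>

definition harmonic :: "('a, 'b) monoid_scheme \<Rightarrow> 'a pmf \<Rightarrow> ('a \<Rightarrow> real) \<Rightarrow> bool" where
  "harmonic G \<eta> h \<longleftrightarrow>
     (\<forall>x\<in>carrier G. ((\<lambda>y. h (x \<otimes>\<^bsub>G\<^esub> y) * pmf \<eta> y) has_sum h x) (carrier G))"

definition liouville :: "('a, 'b) monoid_scheme \<Rightarrow> 'a pmf \<Rightarrow> bool" where
  "liouville G \<eta> \<longleftrightarrow>
     (\<forall>h :: 'a \<Rightarrow> real. bounded (h ` carrier G) \<and> harmonic G \<eta> h \<longrightarrow> h constant_on carrier G)"

text \<open>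
  The Liouville property forces the support of the measure to generate the group: otherwise the
  indicator function of the subgroup generated by the support is bounded, harmonic and not
  constant. Results asserting the Liouville property therefore have to assume that the support
  generates.
\<close>

lemma liouville_imp_generating_support:
  assumes "group G" "pmf_on_group G \<eta>" "liouville G \<eta>"
  shows "generating_set G (set_pmf \<eta>)"
proof -
  interpret group G by fact
  define H where "H = generate G (set_pmf \<eta>)"
  define h :: "'a \<Rightarrow> real" where "h = indicator H"
  have supp: "set_pmf \<eta> \<subseteq> carrier G"
    using assms(2) by (simp add: pmf_on_group_def)
  have sub: "subgroup H G"
    unfolding H_def by (rule generate_is_subgroup[OF supp])
  have mem: "x \<otimes>\<^bsub>G\<^esub> y \<in> H \<longleftrightarrow> x \<in> H" if "x \<in> carrier G" "y \<in> H" for x y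
  proof
    assume "x \<otimes>\<^bsub>G\<^esub> y \<in> H"
    then have "(x \<otimes>\<^bsub>G\<^esub> y) \<otimes>\<^bsub>G\<^esub> inv\<^bsub>G\<^esub> y \<in> H"
      using sub that by (meson subgroup.m_closed subgroup.m_inv_closed)
    then show "x \<in> H"
      using that subgroup.mem_carrier[OF sub] by (simp add: m_assoc)
  qed (use sub that in \<open>simp add: subgroup.m_closed\<close>)
  have total: "(pmf \<eta> has_sum 1) (carrier G)"
  proof -
    have "(\<Sum>\<^sub>\<infinity>y\<in>carrier G. pmf \<eta> y) = measure (measure_pmf \<eta>) (carrier G)"
      using measure_pmf_conv_infsetsum[of \<eta> "carrier G"]
        infsetsum_infsum[OF pmf_abs_summable[of \<eta> "carrier G"]] by simp
    also have "\<dots> = 1"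
      using supp by (metis measure_Int_set_pmf measure_pmf.prob_eq_1 AE_measure_pmf_iff
          sets_measure_pmf UNIV_I subsetD)
    finally show ?thesis
      using pmf_abs_summable[of \<eta> "carrier G"]
      by (metis abs_summable_equivalent abs_summable_summable has_sum_infsum)
  qed
  have "harmonic G \<eta> h"
    unfolding harmonic_def
  proof
    fix x assume x: "x \<in> carrier G"
    have eq: "h (x \<otimes>\<^bsub>G\<^esub> y) * pmf \<eta> y = h x * pmf \<eta> y" for y
    proof (cases "y \<in> set_pmf \<eta>")
      case True
      then have "y \<in> H"
        by (simp add: H_def generate.incl)
      then show ?thesis
        using mem[OF x] by (simp add: h_def indicator_def)
    qed (simp add: set_pmf_iff)
    show "((\<lambda>y. h (x \<otimes>\<^bsub>G\<^esub> y) * pmf \<eta> y) has_sum h x) (carrier G)"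
      unfolding eq using has_sum_cmult_right[OF total, of "h x"] by simp
  qed
  moreover have "bounded (h ` carrier G)"
    by (rule boundedI[of _ 1]) (auto simp: h_def indicator_def)
  ultimately obtain c where c: "\<And>x. x \<in> carrier G \<Longrightarrow> h x = c"
    using assms(3) unfolding liouville_def constant_on_def by blast
  have "h \<one>\<^bsub>G\<^esub> = 1"
    using subgroup.one_closed[OF sub] by (simp add: h_def)
  then have "h x = 1" if "x \<in> carrier G" for x
    using c[OF that] c[OF one_closed] by simp
  then have "carrier G \<subseteq> H"
    by (auto simp: h_def indicator_def split: if_splits)
  then show ?thesis
    using supp subgroup.subset[OF sub] by (auto simp: generating_set_def H_def)
qed

end

theory Submission
  imports Defs "HOL-Probability.Hoeffding"
begin

text \<open>
Write \<open>X\<^sub>n\<close> for the walk with step law \<open>\<eta>\<close>. The proof plays two estimates on the spread of \<open>X\<^sub>n\<close>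
against each other.

\<^emph>\<open>Bounded harmonic functions make the walk spread\<close> (\<open>card_ge_exp_variance\<close>). Let \<open>h\<close> be harmonic
with values in \<open>[-1, 1]\<close> and let \<open>c\<close> be the variance of \<open>h(X\<^sub>1)\<close>. If \<open>X\<^sub>n = s\<^sub>1 \<dots> s\<^sub>n\<close>, then
the sum of \<open>(h(s\<^sub>i) - h(1)) h(s\<^sub>i \<dots> s\<^sub>n)\<close> over \<open>i\<close> has expectation \<open>n c\<close>. But if the value
\<open>v\<close> of \<open>X\<^sub>n\<close> is frozen in advance, and \<open>s\<^sub>i \<dots> s\<^sub>n\<close> is replaced by
\<open>(s\<^sub>1 \<dots> s\<^bsub>i-1\<^esub>)\<inverse> v\<close>, this becomes a sum of bounded martingale differences, whose exponential
moments are at most Gaussian. A union bound over \<open>v \<in> V\<close> shows that a set \<open>V\<close> which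
carries most of the mass of \<open>X\<^sub>n\<close> has at least about \<open>exp(n c\<^sup>2 / 32)\<close> elements. Hence the pair is
Liouville as soon as \<open>X\<^sub>n\<close> is, along a sequence of times and up to small probability, confined to
sets of size \<open>exp(o(n))\<close> (\<open>liouville_if_subexponential_concentration\<close>).

\<^emph>\<open>Almost invariant functions confine the walk\<close> (\<open>prob_quotient_set_ge\<close>). Let \<open>\<phi> \<ge> 0\<close> be an
\<open>\<ell>\<^sup>2\<close>-unit vector with finite support \<open>U\<close>. The overlap \<open>\<langle>\<phi>, R\<^sub>y \<phi>\<rangle>\<close> with the right translate
\<open>R\<^sub>y \<phi>\<close> is at most \<open>1\<close> and vanishes unless \<open>y \<in> U\<inverse> U\<close>, so the probability that
\<open>X\<^sub>n \<in> U\<inverse> U\<close> is at least the mean overlap at \<open>X\<^sub>n\<close>. For symmetric laws the mean overlap at time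
\<open>2n\<close> is at least the square of that at time \<open>n\<close>. So if the mean overlap is \<open>1 - \<theta>\<close> at
time \<open>1\<close>, it is at least \<open>1 - n \<theta>\<close> whenever \<open>n\<close> is a power of two.

It remains to find such \<open>\<phi>\<close>. For every \<open>L\<close> the lower bound on \<open>\<mu>\<^sup>(\<^sup>2\<^sup>n\<^sup>)(id)\<close> at
\<open>n = L\<^sup>3\<close> forces, by the pigeonhole principle, some \<open>k < n\<close> such that from time \<open>2k\<close> to time
\<open>2k + 2\<close> the return probability, summed over two consecutive times, loses at most the fraction
\<open>O(L\<^sup>-\<^sup>2)\<close>. The corresponding heat kernel, truncated at a low level and normalised, has support
of size \<open>exp(O(L))\<close>, and its translate by \<open>g\<close> is at distance \<open>O(|g| / L)\<close>
from it (\<open>almost_invariant_functions\<close>). Therefore \<open>\<theta> \<le> E min(1, O(|X\<^sub>1|\<^sup>2 / L\<^sup>2))\<close>, and a finite first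
moment makes this \<open>o(1 / L)\<close> (\<open>truncated_second_moment_small\<close>). Running the walk for a time
\<open>n\<close> of order \<open>L / \<epsilon>\<close> gives \<open>n \<theta> \<rightarrow> 0\<close> while \<open>|U\<inverse> U| \<le> exp(\<epsilon> n)\<close>
(\<open>subexponential_concentration\<close>).
\<close>

section \<open>Expectations under discrete distributions\<close>

lemma integrable_pmf_bounded:
  fixes f :: "'c \<Rightarrow> real"
  assumes "\<And>x. x \<in> set_pmf M \<Longrightarrow> \<bar>f x\<bar> \<le> B"
  shows "integrable (measure_pmf M) f"
  by (rule measure_pmf.integrable_const_bound[where B = B]) (auto simp: AE_measure_pmf_iff assms)

text \<open>
The integrand need only be bounded on the support. It is clipped to make it bounded everywhere.
\<close>
lemma expectation_bind_pmf:
  fixes f :: "'d \<Rightarrow> real"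
  assumes "\<And>x y. x \<in> set_pmf M \<Longrightarrow> y \<in> set_pmf (N x) \<Longrightarrow> \<bar>f y\<bar> \<le> B"
  shows "measure_pmf.expectation (bind_pmf M N) f
       = measure_pmf.expectation M (\<lambda>x. measure_pmf.expectation (N x) f)"
proof -
  obtain x0 y0 where "x0 \<in> set_pmf M" "y0 \<in> set_pmf (N x0)"
    using set_pmf_not_empty by (metis ex_in_conv)
  then have B: "B \<ge> 0"
    using assms by (meson abs_ge_zero order_trans)
  define g where "g y = max (- B) (min B (f y))" for y
  have g: "g y = f y" if "x \<in> set_pmf M" "y \<in> set_pmf (N x)" for x y
    using assms[OF that] by (auto simp: g_def)
  have gB: "\<bar>g y\<bar> \<le> B" for y
    using B by (auto simp: g_def)
  have "measure_pmf.expectation (bind_pmf M N) f = measure_pmf.expectation (bind_pmf M N) g"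
    by (rule Bochner_Integration.integral_cong_AE) (auto simp: AE_measure_pmf_iff g)
  also have "\<dots> = measure_pmf.expectation M (\<lambda>x. measure_pmf.expectation (N x) g)"
    unfolding measure_pmf_bind
    by (subst integral_bind[where K = "count_space UNIV" and B = B and B' = 1])
       (auto simp: gB measure_pmf.finite_measure_axioms space_subprob_algebra
          intro: measure_pmf.subprob_space_axioms)
  also have "\<dots> = measure_pmf.expectation M (\<lambda>x. measure_pmf.expectation (N x) f)"
    by (rule Bochner_Integration.integral_cong_AE)
       (auto simp: AE_measure_pmf_iff g intro!: Bochner_Integration.integral_cong_AE)
  finally show ?thesis .
qed

lemma expectation_swap:
  fixes f :: "'c \<Rightarrow> 'd \<Rightarrow> real"
  assumes "\<And>x y. x \<in> set_pmf M \<Longrightarrow> y \<in> set_pmf N \<Longrightarrow> \<bar>f x y\<bar> \<le> B"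
  shows "measure_pmf.expectation M (\<lambda>x. measure_pmf.expectation N (f x))
       = measure_pmf.expectation N (\<lambda>y. measure_pmf.expectation M (\<lambda>x. f x y))"
proof -
  have 1: "measure_pmf.expectation (bind_pmf M (\<lambda>x. map_pmf (f x) N)) (\<lambda>z. z)
      = measure_pmf.expectation M (\<lambda>x. measure_pmf.expectation N (f x))"
    by (subst expectation_bind_pmf[where B = B]) (auto simp: assms)
  have 2: "measure_pmf.expectation (bind_pmf N (\<lambda>y. map_pmf (\<lambda>x. f x y) M)) (\<lambda>z. z)
      = measure_pmf.expectation N (\<lambda>y. measure_pmf.expectation M (\<lambda>x. f x y))"
    by (subst expectation_bind_pmf[where B = B]) (auto simp: assms)
  have "bind_pmf M (\<lambda>x. map_pmf (f x) N) = bind_pmf N (\<lambda>y. map_pmf (\<lambda>x. f x y) M)"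
    unfolding map_pmf_def by (rule bind_commute_pmf)
  then show ?thesis using 1 2 by simp
qed

lemma expectation_mono_bounded:
  fixes f g :: "'c \<Rightarrow> real"
  assumes "\<And>x. x \<in> set_pmf M \<Longrightarrow> f x \<le> g x"
    and "\<And>x. x \<in> set_pmf M \<Longrightarrow> \<bar>f x\<bar> \<le> A"
    and "\<And>x. x \<in> set_pmf M \<Longrightarrow> \<bar>g x\<bar> \<le> B"
  shows "measure_pmf.expectation M f \<le> measure_pmf.expectation M g"
  using assms by (intro integral_mono_AE integrable_pmf_bounded) (auto simp: AE_measure_pmf_iff)

lemma abs_expectation_le:
  fixes f :: "'c \<Rightarrow> real"
  assumes "\<And>x. x \<in> set_pmf M \<Longrightarrow> \<bar>f x\<bar> \<le> B"
  shows "\<bar>measure_pmf.expectation M f\<bar> \<le> B"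
proof -
  have "integrable (measure_pmf M) f"
    using assms by (rule integrable_pmf_bounded)
  then have "measure_pmf.expectation M f \<le> B" "- B \<le> measure_pmf.expectation M f"
    using assms
    by (auto intro!: measure_pmf.integral_le_const measure_pmf.integral_ge_const
        simp: AE_measure_pmf_iff abs_le_iff minus_le_iff)
  then show ?thesis by (simp add: abs_le_iff minus_le_iff)
qed

lemma expectation_cong_support:
  fixes f g :: "'c \<Rightarrow> real"
  assumes "\<And>x. x \<in> set_pmf M \<Longrightarrow> f x = g x"
  shows "measure_pmf.expectation M f = measure_pmf.expectation M g"
  using assms by (intro Bochner_Integration.integral_cong_AE) (auto simp: AE_measure_pmf_iff)

lemma expectation_eq_has_sum:
  fixes f :: "'c \<Rightarrow> real"
  assumes "set_pmf M \<subseteq> A" and "((\<lambda>x. f x * pmf M x) has_sum s) A"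
  shows "measure_pmf.expectation M f = s"
proof -
  have "(\<lambda>x. f x * pmf M x) summable_on A"
    using assms(2) by (auto simp: summable_on_def)
  then have ab: "(\<lambda>x. f x * pmf M x) abs_summable_on A"
    by (intro iffD1[OF abs_summable_equivalent] iffD1[OF summable_on_iff_abs_summable_on_real])
  have "measure_pmf.expectation M f = infsetsum (\<lambda>x. pmf M x * f x) UNIV"
    unfolding infsetsum_def measure_pmf_eq_density by (subst integral_density) simp_all
  also have "\<dots> = infsetsum (\<lambda>x. f x * pmf M x) A"
    using assms(1) by (intro infsetsum_cong_neutral) (auto simp: set_pmf_eq)
  also have "\<dots> = s"
    using infsetsum_infsum[OF ab] infsumI[OF assms(2)] by simp
  finally show ?thesis .
qed

section \<open>Convolution on a group\<close>

lemma convolution_pmf_bind: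
  "convolution_pmf G \<mu> \<nu> = bind_pmf \<mu> (\<lambda>x. map_pmf (\<lambda>y. x \<otimes>\<^bsub>G\<^esub> y) \<nu>)"
  by (simp add: convolution_pmf_def pair_pmf_def map_bind_pmf map_pmf_def bind_assoc_pmf bind_return_pmf)

context group begin

lemma convolution_support:
  assumes "set_pmf \<mu> \<subseteq> carrier G" "set_pmf \<nu> \<subseteq> carrier G"
  shows "set_pmf (convolution_pmf G \<mu> \<nu>) \<subseteq> carrier G"
  using assms by (auto simp: convolution_pmf_def)

lemma convolution_assoc:
  assumes "set_pmf \<mu> \<subseteq> carrier G" "set_pmf \<nu> \<subseteq> carrier G" "set_pmf \<rho> \<subseteq> carrier G"
  shows "convolution_pmf G (convolution_pmf G \<mu> \<nu>) \<rho> = convolution_pmf G \<mu> (convolution_pmf G \<nu> \<rho>)"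
  unfolding convolution_pmf_bind bind_assoc_pmf bind_map_pmf map_bind_pmf map_pmf_comp
  using assms by (intro bind_pmf_cong map_pmf_cong refl) (auto simp: m_assoc subset_eq)

lemma convolution_one_left:
  assumes "set_pmf \<nu> \<subseteq> carrier G"
  shows "convolution_pmf G (return_pmf \<one>) \<nu> = \<nu>"
proof -
  have "map_pmf (\<lambda>y. \<one> \<otimes> y) \<nu> = map_pmf (\<lambda>y. y) \<nu>"
    using assms by (intro map_pmf_cong) auto
  then show ?thesis by (simp add: convolution_pmf_bind bind_return_pmf)
qed

lemma convolution_one_right:
  assumes "set_pmf \<nu> \<subseteq> carrier G"
  shows "convolution_pmf G \<nu> (return_pmf \<one>) = \<nu>"
proof -
  have "bind_pmf \<nu> (\<lambda>x. return_pmf (x \<otimes> \<one>)) = bind_pmf \<nu> return_pmf"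
    using assms by (intro bind_pmf_cong) auto
  then show ?thesis by (simp add: convolution_pmf_bind bind_return_pmf')
qed

lemma convolution_power_support:
  assumes "set_pmf \<mu> \<subseteq> carrier G"
  shows "set_pmf (convolution_power G \<mu> n) \<subseteq> carrier G"
  by (induction n) (use assms convolution_support in auto)

lemma convolution_power_add:
  assumes "set_pmf \<mu> \<subseteq> carrier G"
  shows "convolution_power G \<mu> (m + n)
       = convolution_pmf G (convolution_power G \<mu> m) (convolution_power G \<mu> n)"
  by (induction n)
     (simp_all add: convolution_one_right convolution_power_support assms convolution_assoc)

lemma convolution_power_Suc_left:
  assumes "set_pmf \<mu> \<subseteq> carrier G"
  shows "convolution_power G \<mu> (Suc n) = convolution_pmf G \<mu> (convolution_power G \<mu> n)"
  using convolution_power_add[OF assms, of 1 n] assms by (simp add: convolution_one_left)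

lemma symmetric_pmf_map_inv:
  assumes "set_pmf \<mu> \<subseteq> carrier G" "symmetric_pmf G \<mu>"
  shows "map_pmf (m_inv G) \<mu> = \<mu>"
proof (rule pmf_eqI)
  fix x
  show "pmf (map_pmf (m_inv G) \<mu>) x = pmf \<mu> x"
  proof (cases "x \<in> carrier G")
    case True
    have "m_inv G -` {x} \<inter> set_pmf \<mu> = {inv x} \<inter> set_pmf \<mu>"
      using assms(1) True by auto
    then have "measure (measure_pmf \<mu>) (m_inv G -` {x}) = measure (measure_pmf \<mu>) {inv x}"
      by (metis measure_Int_set_pmf)
    then have "pmf (map_pmf (m_inv G) \<mu>) x = pmf \<mu> (inv x)"
      by (simp add: pmf_map measure_pmf_single)
    then show ?thesis
      using assms(2) True by (metis symmetric_pmf_def)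
  next
    case False
    then have "x \<notin> set_pmf (map_pmf (m_inv G) \<mu>)" "x \<notin> set_pmf \<mu>"
      using assms(1) by auto
    then show ?thesis by (metis set_pmf_iff)
  qed
qed

lemma map_inv_convolution:
  assumes "set_pmf \<mu> \<subseteq> carrier G" "set_pmf \<nu> \<subseteq> carrier G"
  shows "map_pmf (m_inv G) (convolution_pmf G \<mu> \<nu>)
       = convolution_pmf G (map_pmf (m_inv G) \<nu>) (map_pmf (m_inv G) \<mu>)"
proof -
  have "map_pmf (m_inv G) (convolution_pmf G \<mu> \<nu>)
      = bind_pmf \<mu> (\<lambda>x. bind_pmf \<nu> (\<lambda>y. return_pmf (inv y \<otimes> inv x)))"
    unfolding convolution_pmf_bind map_bind_pmf map_pmf_comp unfolding map_pmf_def
    using assms by (intro bind_pmf_cong refl) (auto simp: inv_mult_group subset_eq)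
  also have "\<dots> = bind_pmf \<nu> (\<lambda>y. bind_pmf \<mu> (\<lambda>x. return_pmf (inv y \<otimes> inv x)))"
    by (rule bind_commute_pmf)
  also have "\<dots> = convolution_pmf G (map_pmf (m_inv G) \<nu>) (map_pmf (m_inv G) \<mu>)"
    unfolding convolution_pmf_bind bind_map_pmf map_pmf_comp unfolding map_pmf_def ..
  finally show ?thesis .
qed

lemma map_inv_convolution_power:
  assumes "set_pmf \<mu> \<subseteq> carrier G" "symmetric_pmf G \<mu>"
  shows "map_pmf (m_inv G) (convolution_power G \<mu> n) = convolution_power G \<mu> n"
proof (induction n)
  case (Suc n)
  have "map_pmf (m_inv G) (convolution_power G \<mu> (Suc n))
      = convolution_pmf G \<mu> (convolution_power G \<mu> n)"
    using map_inv_convolution[OF convolution_power_support[OF assms(1)] assms(1)] Suc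
      symmetric_pmf_map_inv[OF assms] by simp
  then show ?case
    using convolution_power_Suc_left[OF assms(1)] by simp
qed simp

end

section \<open>A bounded harmonic function forces the walk to spread exponentially\<close>

lemma expectation_exp_le:
  fixes f :: "'c \<Rightarrow> real"
  assumes "\<And>x. x \<in> set_pmf M \<Longrightarrow> \<bar>f x\<bar> \<le> 2" and "measure_pmf.expectation M f = 0" and "t > 0"
  shows "measure_pmf.expectation M (\<lambda>x. exp (t * f x)) \<le> exp (2 * t\<^sup>2)"
proof -
  interpret interval_bounded_random_variable "measure_pmf M" f "-2" 2
    using assms(1) by unfold_locales (auto simp: AE_measure_pmf_iff abs_le_iff minus_le_iff)
  have "\<bar>exp (t * f x)\<bar> \<le> exp (t * 2)" if "x \<in> set_pmf M" for x
    using assms(1)[OF that] assms(3) by (auto simp: abs_le_iff)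
  then have "integrable (measure_pmf M) (\<lambda>x. exp (t * f x))"
    by (rule integrable_pmf_bounded)
  then have "ennreal (measure_pmf.expectation M (\<lambda>x. exp (t * f x)))
      = (\<integral>\<^sup>+ x. exp (t * f x) \<partial>measure_pmf M)"
    by (subst nn_integral_eq_integral) auto
  also have "\<dots> \<le> ennreal (exp (t\<^sup>2 * (2 - (-2))\<^sup>2 / 8))"
    by (rule Hoeffdings_lemma_nn_integral_0[OF assms(3,2)])
  finally show ?thesis by (simp add: mult.commute)
qed

text \<open>
The walk is built by prepending increments, so that the first component after \<open>n\<close> steps is
\<open>s\<^sub>1 \<dots> s\<^sub>n\<close> with \<open>s\<^sub>1\<close> the most recent letter. The second component then accumulates the sum of
\<open>(h(s\<^sub>i) - h(1)) h(s\<^sub>i \<dots> s\<^sub>n)\<close> as a Markov functional: a new letter leaves the suffixes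
\<open>s\<^sub>i \<dots> s\<^sub>n\<close> already seen unchanged.
\<close>
primrec increment_walk ::
  "('a, 'b) monoid_scheme \<Rightarrow> 'a pmf \<Rightarrow> ('a \<Rightarrow> real) \<Rightarrow> nat \<Rightarrow> ('a \<times> real) pmf" where
  "increment_walk G \<eta> h 0 = return_pmf (\<one>\<^bsub>G\<^esub>, 0)"
| "increment_walk G \<eta> h (Suc n) = bind_pmf (increment_walk G \<eta> h n) (\<lambda>w.
     map_pmf (\<lambda>s. (s \<otimes>\<^bsub>G\<^esub> fst w, snd w + (h s - h \<one>\<^bsub>G\<^esub>) * h (s \<otimes>\<^bsub>G\<^esub> fst w))) \<eta>)"

context group begin

text \<open>
The new letter is multiplied from the left here, but from the right in a convolution power. The
laws agree because the letters are independent and identically distributed.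
\<close>
lemma map_fst_increment_walk:
  assumes "set_pmf \<eta> \<subseteq> carrier G"
  shows "map_pmf fst (increment_walk G \<eta> h n) = convolution_power G \<eta> n"
proof (induction n)
  case (Suc n)
  have "map_pmf fst (increment_walk G \<eta> h (Suc n))
      = bind_pmf (map_pmf fst (increment_walk G \<eta> h n)) (\<lambda>y. map_pmf (\<lambda>s. s \<otimes> y) \<eta>)"
    by (simp add: map_bind_pmf map_pmf_comp bind_map_pmf)
  also have "\<dots> = bind_pmf \<eta> (\<lambda>s. map_pmf (\<lambda>y. s \<otimes> y) (convolution_power G \<eta> n))"
    unfolding Suc unfolding map_pmf_def by (rule bind_commute_pmf)
  also have "\<dots> = convolution_power G \<eta> (Suc n)"
    using convolution_power_Suc_left[OF assms] by (simp add: convolution_pmf_bind)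
  finally show ?case .
qed simp

lemma fst_increment_walk_closed:
  assumes "set_pmf \<eta> \<subseteq> carrier G" "w \<in> set_pmf (increment_walk G \<eta> h n)"
  shows "fst w \<in> carrier G"
proof -
  have "fst w \<in> set_pmf (map_pmf fst (increment_walk G \<eta> h n))"
    using assms(2) by simp
  then have "fst w \<in> set_pmf (convolution_power G \<eta> n)"
    unfolding map_fst_increment_walk[OF assms(1)] .
  then show ?thesis
    using convolution_power_support[OF assms(1)] by blast
qed

lemma harmonic_increment_bounds:
  fixes h :: "'a \<Rightarrow> real"
  assumes "\<And>x. x \<in> carrier G \<Longrightarrow> \<bar>h x\<bar> \<le> 1" "s \<in> carrier G" "y \<in> carrier G"
  shows "\<bar>h s - h \<one>\<bar> \<le> 2" and "\<bar>(h s - h \<one>) * h (s \<otimes> y)\<bar> \<le> 2"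
proof -
  show 2: "\<bar>h s - h \<one>\<bar> \<le> 2"
    using assms(1)[OF assms(2)] assms(1)[OF one_closed] by linarith
  have "\<bar>h s - h \<one>\<bar> * \<bar>h (s \<otimes> y)\<bar> \<le> 2 * 1"
    by (rule mult_mono) (use 2 assms in auto)
  then show "\<bar>(h s - h \<one>) * h (s \<otimes> y)\<bar> \<le> 2"
    by (simp add: abs_mult)
qed

lemma snd_increment_walk_bound:
  assumes "set_pmf \<eta> \<subseteq> carrier G" "\<And>x. x \<in> carrier G \<Longrightarrow> \<bar>h x\<bar> \<le> 1"
  shows "w \<in> set_pmf (increment_walk G \<eta> h n) \<Longrightarrow> \<bar>snd w\<bar> \<le> 2 * real n"
proof (induction n arbitrary: w)
  case (Suc n)
  then obtain v s where vs: "v \<in> set_pmf (increment_walk G \<eta> h n)" "s \<in> set_pmf \<eta>"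
      and w: "snd w = snd v + (h s - h \<one>) * h (s \<otimes> fst v)"
    by auto
  have "\<bar>(h s - h \<one>) * h (s \<otimes> fst v)\<bar> \<le> 2"
    using vs fst_increment_walk_closed[OF assms(1)] assms by (intro harmonic_increment_bounds) auto
  then show ?case
    using Suc.IH[OF vs(1)] unfolding w by (simp add: abs_le_iff)
qed simp

context
  fixes \<eta> :: "'a pmf" and h :: "'a \<Rightarrow> real"
  assumes supp: "set_pmf \<eta> \<subseteq> carrier G"
    and bdd: "\<And>x. x \<in> carrier G \<Longrightarrow> \<bar>h x\<bar> \<le> 1"
    and harm: "\<And>x. x \<in> carrier G \<Longrightarrow> measure_pmf.expectation \<eta> (\<lambda>s. h (x \<otimes> s)) = h x"
begin

lemma increment_walk_bound: "w \<in> set_pmf (increment_walk G \<eta> h n) \<Longrightarrow> \<bar>snd w\<bar> \<le> 2 * real n"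
  using snd_increment_walk_bound[of \<eta> h] supp bdd by blast

lemma harmonic_convolution_power:
  assumes "x \<in> carrier G"
  shows "measure_pmf.expectation (convolution_power G \<eta> n) (\<lambda>y. h (x \<otimes> y)) = h x"
proof (induction n)
  case (Suc n)
  note P = convolution_power_support[OF supp, of n]
  have "measure_pmf.expectation (convolution_power G \<eta> (Suc n)) (\<lambda>y. h (x \<otimes> y))
      = measure_pmf.expectation (convolution_power G \<eta> n)
          (\<lambda>y. measure_pmf.expectation \<eta> (\<lambda>s. h (x \<otimes> (y \<otimes> s))))"
    unfolding convolution_power.simps convolution_pmf_bind
    using P supp assms by (subst expectation_bind_pmf[where B = 1]) (auto intro!: bdd m_closed)
  also have "\<dots> = measure_pmf.expectation (convolution_power G \<eta> n) (\<lambda>y. h (x \<otimes> y))"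
  proof (rule expectation_cong_support)
    fix y assume "y \<in> set_pmf (convolution_power G \<eta> n)"
    then have y: "y \<in> carrier G" using P by blast
    have "measure_pmf.expectation \<eta> (\<lambda>s. h (x \<otimes> (y \<otimes> s)))
        = measure_pmf.expectation \<eta> (\<lambda>s. h ((x \<otimes> y) \<otimes> s))"
      using supp y assms by (intro expectation_cong_support) (auto simp: m_assoc subset_eq)
    then show "measure_pmf.expectation \<eta> (\<lambda>s. h (x \<otimes> (y \<otimes> s))) = h (x \<otimes> y)"
      using harm y assms by simp
  qed
  finally show ?case using Suc by simp
qed (use assms in simp)

abbreviation "harmonic_variance \<equiv> measure_pmf.expectation \<eta> (\<lambda>s. (h s - h \<one>)\<^sup>2)"

lemma expectation_h: "measure_pmf.expectation \<eta> h = h \<one>"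
proof -
  have "measure_pmf.expectation \<eta> h = measure_pmf.expectation \<eta> (\<lambda>s. h (\<one> \<otimes> s))"
    using supp by (intro expectation_cong_support) auto
  then show ?thesis using harm[OF one_closed] by simp
qed

lemma expectation_increment: "measure_pmf.expectation \<eta> (\<lambda>s. h s - h \<one>) = 0"
proof -
  have "integrable (measure_pmf \<eta>) h"
    by (rule integrable_pmf_bounded[where B = 1]) (use bdd supp in auto)
  then show ?thesis using expectation_h by simp
qed

text \<open>
Given the new letter \<open>s\<close>, harmonicity replaces \<open>h(s X\<^sub>n)\<close> by its mean \<open>h(s)\<close>. Each step therefore
contributes \<open>E (h(s) - h(1)) h(s)\<close>, the variance of \<open>h\<close> under \<open>\<eta>\<close>, since \<open>E h(s) = h(1)\<close>.
\<close>
lemma expectation_increment_walk: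
  "measure_pmf.expectation (increment_walk G \<eta> h n) snd = real n * harmonic_variance"
proof (induction n)
  case (Suc n)
  let ?W = "increment_walk G \<eta> h n"
  let ?d = "\<lambda>w s. (h s - h \<one>) * h (s \<otimes> fst w)"
  note W = fst_increment_walk_closed[OF supp] increment_walk_bound
  have dB: "\<bar>?d w s\<bar> \<le> 2" if "w \<in> set_pmf ?W" "s \<in> set_pmf \<eta>" for w s
    using W(1)[OF that(1)] that(2) supp bdd by (intro harmonic_increment_bounds) auto
  have inner: "\<bar>measure_pmf.expectation \<eta> (?d w)\<bar> \<le> 2" if "w \<in> set_pmf ?W" for w
    using dB[OF that] by (rule abs_expectation_le)
  have "measure_pmf.expectation (increment_walk G \<eta> h (Suc n)) snd
      = measure_pmf.expectation ?W (\<lambda>w. measure_pmf.expectation \<eta> (\<lambda>s. snd w + ?d w s))"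
    unfolding increment_walk.simps
  proof (subst expectation_bind_pmf[where B = "2 * real (Suc n)"])
    fix w z assume "w \<in> set_pmf ?W" "z \<in> set_pmf (map_pmf (\<lambda>s. (s \<otimes> fst w, snd w + ?d w s)) \<eta>)"
    then have "z \<in> set_pmf (increment_walk G \<eta> h (Suc n))" by auto
    then show "\<bar>snd z\<bar> \<le> 2 * real (Suc n)" by (rule W(2))
  qed simp
  also have "\<dots> = measure_pmf.expectation ?W (\<lambda>w. snd w + measure_pmf.expectation \<eta> (?d w))"
    by (intro expectation_cong_support, subst Bochner_Integration.integral_add)
       (auto intro!: integrable_pmf_bounded dB)
  also have "\<dots> = measure_pmf.expectation ?W snd
      + measure_pmf.expectation ?W (\<lambda>w. measure_pmf.expectation \<eta> (?d w))"
    by (intro Bochner_Integration.integral_add integrable_pmf_bounded[OF W(2)]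
        integrable_pmf_bounded[OF inner])
  also have "measure_pmf.expectation ?W (\<lambda>w. measure_pmf.expectation \<eta> (?d w))
      = measure_pmf.expectation \<eta> (\<lambda>s. measure_pmf.expectation ?W (\<lambda>w. ?d w s))"
    by (rule expectation_swap[OF dB])
  also have "\<dots> = measure_pmf.expectation \<eta> (\<lambda>s. (h s - h \<one>) * h s)"
  proof (rule expectation_cong_support)
    fix s assume "s \<in> set_pmf \<eta>"
    then have s: "s \<in> carrier G" using supp by blast
    have "measure_pmf.expectation ?W (\<lambda>w. h (s \<otimes> fst w))
        = measure_pmf.expectation (map_pmf fst ?W) (\<lambda>y. h (s \<otimes> y))" by simp
    then show "measure_pmf.expectation ?W (\<lambda>w. ?d w s) = (h s - h \<one>) * h s"
      using harmonic_convolution_power[OF s] by (simp add: map_fst_increment_walk[OF supp])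
  qed
  also have "\<dots> = measure_pmf.expectation \<eta> (\<lambda>s. (h s - h \<one>)\<^sup>2 + h \<one> * (h s - h \<one>))"
    by (intro arg_cong[where f = "measure_pmf.expectation \<eta>"] ext)
       (simp add: power2_eq_square algebra_simps)
  also have "\<dots> = harmonic_variance + measure_pmf.expectation \<eta> (\<lambda>s. h \<one> * (h s - h \<one>))"
  proof (rule Bochner_Integration.integral_add)
    have d: "\<bar>h s - h \<one>\<bar> \<le> 2" if "s \<in> set_pmf \<eta>" for s
      using that supp bdd by (intro harmonic_increment_bounds(1)[of h s \<one>]) auto
    then have "\<bar>(h s - h \<one>)\<^sup>2\<bar> \<le> 4" if "s \<in> set_pmf \<eta>" for s
      using power_mono[OF d[OF that], of 2] by simp
    then show "integrable (measure_pmf \<eta>) (\<lambda>s. (h s - h \<one>)\<^sup>2)"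
      by (rule integrable_pmf_bounded)
    show "integrable (measure_pmf \<eta>) (\<lambda>s. h \<one> * (h s - h \<one>))"
      by (intro integrable_mult_right integrable_pmf_bounded[OF d])
  qed
  also have "\<dots> = harmonic_variance"
    using expectation_increment by simp
  finally show ?case
    using Suc by (simp add: algebra_simps)
qed simp

text \<open>
On the event that the walk sits at the prescribed point \<open>v\<close>, the factor \<open>h(s X\<^sub>n)\<close> of the last
increment is the constant \<open>h(v)\<close>. That increment is then a multiple of the centred variable
\<open>h(s) - h(1)\<close> and costs only the factor \<open>exp(2 t\<^sup>2)\<close> of Hoeffding's lemma, while the preceding
walk sits at the prescribed point \<open>s\<inverse> v\<close>, to which the induction hypothesis applies.
\<close>
lemma exponential_moment_increment_walk:
  assumes "t > 0"
  shows "v \<in> carrier G \<Longrightarrow>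
    measure_pmf.expectation (increment_walk G \<eta> h n) (\<lambda>w. indicator {v} (fst w) * exp (t * snd w))
      \<le> exp (2 * t\<^sup>2 * real n)"
proof (induction n arbitrary: v)
  case 0
  then show ?case by (simp add: indicator_def)
next
  case (Suc n)
  let ?W = "increment_walk G \<eta> h n"
  let ?a = "\<lambda>s. h s - h \<one>"
  let ?K = "\<lambda>x. measure_pmf.expectation ?W (\<lambda>w. indicator {x} (fst w) * exp (t * snd w))"
  have K0: "0 \<le> ?K x" for x
    by (intro Bochner_Integration.integral_nonneg) simp
  note W = fst_increment_walk_closed[OF supp] increment_walk_bound
  have eB: "indicator {v} y * exp (t * f) \<le> exp (t * (2 * real (Suc n)))"
    if "\<bar>f\<bar> \<le> 2 * real (Suc n)" for f and y
    using that assms by (auto simp: indicator_def abs_le_iff simp del: of_nat_Suc)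
  have bound: "\<bar>indicator {v} (s \<otimes> fst w) * exp (t * (snd w + ?a s * h (s \<otimes> fst w)))\<bar>
      \<le> exp (t * (2 * real (Suc n)))"
    if "w \<in> set_pmf ?W" "s \<in> set_pmf \<eta>" for w s
  proof -
    have "(s \<otimes> fst w, snd w + ?a s * h (s \<otimes> fst w)) \<in> set_pmf (increment_walk G \<eta> h (Suc n))"
      using that by auto
    from W(2)[OF this] show ?thesis using eB by (simp add: abs_mult)
  qed
  have aB: "\<bar>?a s * h v\<bar> \<le> 2" if "s \<in> set_pmf \<eta>" for s
  proof -
    have "s \<in> carrier G" using that supp by blast
    moreover from this have "s \<otimes> (inv s \<otimes> v) = v" using Suc.prems by (simp add: m_assoc[symmetric])
    ultimately show ?thesis
      using harmonic_increment_bounds(2)[of h s "inv s \<otimes> v"] bdd Suc.prems by simp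
  qed
  have "measure_pmf.expectation (increment_walk G \<eta> h (Suc n))
          (\<lambda>w. indicator {v} (fst w) * exp (t * snd w))
      = measure_pmf.expectation ?W (\<lambda>w. measure_pmf.expectation \<eta>
          (\<lambda>s. indicator {v} (s \<otimes> fst w) * exp (t * (snd w + ?a s * h (s \<otimes> fst w)))))"
    unfolding increment_walk.simps
    by (subst expectation_bind_pmf[where B = "exp (t * (2 * real (Suc n)))"])
       (use bound in auto)
  also have "\<dots> = measure_pmf.expectation \<eta> (\<lambda>s. measure_pmf.expectation ?W
          (\<lambda>w. indicator {v} (s \<otimes> fst w) * exp (t * (snd w + ?a s * h (s \<otimes> fst w)))))"
    by (rule expectation_swap[OF bound])
  also have "\<dots> = measure_pmf.expectation \<eta> (\<lambda>s. exp (t * (?a s * h v)) * ?K (inv s \<otimes> v))"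
  proof (rule expectation_cong_support)
    fix s assume "s \<in> set_pmf \<eta>"
    then have s: "s \<in> carrier G" using supp by blast
    have "measure_pmf.expectation ?W
          (\<lambda>w. indicator {v} (s \<otimes> fst w) * exp (t * (snd w + ?a s * h (s \<otimes> fst w))))
        = measure_pmf.expectation ?W
          (\<lambda>w. exp (t * (?a s * h v)) * (indicator {inv s \<otimes> v} (fst w) * exp (t * snd w)))"
    proof (rule expectation_cong_support)
      fix w assume "w \<in> set_pmf ?W"
      then have w: "fst w \<in> carrier G" using W(1) by blast
      have iff: "s \<otimes> fst w = v \<longleftrightarrow> fst w = inv s \<otimes> v"
        using s w Suc.prems by (metis inv_closed inv_solve_left m_closed)
      show "indicator {v} (s \<otimes> fst w) * exp (t * (snd w + ?a s * h (s \<otimes> fst w)))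
          = exp (t * (?a s * h v)) * (indicator {inv s \<otimes> v} (fst w) * exp (t * snd w))"
        using iff by (cases "s \<otimes> fst w = v") (auto simp: exp_add[symmetric] algebra_simps)
    qed
    then show "measure_pmf.expectation ?W
          (\<lambda>w. indicator {v} (s \<otimes> fst w) * exp (t * (snd w + ?a s * h (s \<otimes> fst w))))
        = exp (t * (?a s * h v)) * ?K (inv s \<otimes> v)" by simp
  qed
  also have "\<dots> \<le> measure_pmf.expectation \<eta> (\<lambda>s. exp (t * (?a s * h v)) * exp (2 * t\<^sup>2 * real n))"
  proof (rule expectation_mono_bounded[where A = "exp (t * 2) * exp (2 * t\<^sup>2 * real n)"
        and B = "exp (t * 2) * exp (2 * t\<^sup>2 * real n)"])
    fix s assume s: "s \<in> set_pmf \<eta>"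
    have IH: "?K (inv s \<otimes> v) \<le> exp (2 * t\<^sup>2 * real n)"
      using s supp Suc.prems by (intro Suc.IH) auto
    have e: "exp (t * (?a s * h v)) \<le> exp (t * 2)"
      using aB[OF s] assms by (auto simp: abs_le_iff)
    show "exp (t * (?a s * h v)) * ?K (inv s \<otimes> v) \<le> exp (t * (?a s * h v)) * exp (2 * t\<^sup>2 * real n)"
      using IH by simp
    show "\<bar>exp (t * (?a s * h v)) * ?K (inv s \<otimes> v)\<bar> \<le> exp (t * 2) * exp (2 * t\<^sup>2 * real n)"
      unfolding abs_mult using IH K0[of "inv s \<otimes> v"] e by (intro mult_mono) auto
    show "\<bar>exp (t * (?a s * h v)) * exp (2 * t\<^sup>2 * real n)\<bar> \<le> exp (t * 2) * exp (2 * t\<^sup>2 * real n)"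
      using e by simp
  qed
  also have "\<dots> = measure_pmf.expectation \<eta> (\<lambda>s. exp (t * (?a s * h v))) * exp (2 * t\<^sup>2 * real n)"
    by simp
  also have "\<dots> \<le> exp (2 * t\<^sup>2) * exp (2 * t\<^sup>2 * real n)"
    using expectation_increment aB assms
    by (intro mult_right_mono expectation_exp_le) auto
  also have "\<dots> = exp (2 * t\<^sup>2 * real (Suc n))"
    by (simp add: exp_add[symmetric] algebra_simps)
  finally show ?case .
qed

text \<open>
The mean of the second component is \<open>n c\<close> with \<open>c\<close> the variance, and removing an event of
probability \<open>\<delta> \<le> c/4\<close> lowers it by at most \<open>2 n \<delta>\<close>, so \<open>n c / 2\<close> survives on the event
that the walk lies in \<open>V\<close>. Summing the previous bound over \<open>v \<in> V\<close> limits the exponential moment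
on this event to \<open>|V| exp(2 t\<^sup>2 n)\<close>. Comparing the two through the tangent inequality
\<open>exp(x) \<ge> exp(u) (1 + x - u)\<close> at \<open>u = t n c / 2\<close> gives the claim for the optimal choice \<open>t = c/8\<close>.
\<close>
lemma card_ge_exp_variance:
  assumes "finite V" "V \<subseteq> carrier G"
    and prob: "measure (measure_pmf (convolution_power G \<eta> n)) V \<ge> 1 - \<delta>"
    and \<delta>: "\<delta> \<le> harmonic_variance / 4" and c: "harmonic_variance > 0"
  shows "(1 - \<delta>) * exp (real n * harmonic_variance\<^sup>2 / 32) \<le> real (card V)"
proof -
  let ?W = "increment_walk G \<eta> h n"
  define c where "c = harmonic_variance"
  define t where "t = c / 8"
  define u where "u = t * real n * c / 2"
  have t: "t > 0" using c by (simp add: t_def c_def)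
  have u: "u \<ge> 0" using c by (simp add: u_def t_def c_def)
  note bnd = increment_walk_bound
  have tb: "\<bar>t * snd w\<bar> \<le> 2 * t * real n" if "w \<in> set_pmf ?W" for w
  proof -
    have "t * \<bar>snd w\<bar> \<le> t * (2 * real n)" using bnd[OF that] t by (intro mult_left_mono) auto
    then show ?thesis using t by (simp add: abs_mult mult_ac)
  qed
  have PV: "measure_pmf.expectation ?W (\<lambda>w. indicator V (fst w) :: real)
      = measure (measure_pmf (convolution_power G \<eta> n)) V"
  proof -
    have "measure_pmf.expectation ?W (\<lambda>w. indicator V (fst w) :: real)
      = measure_pmf.expectation (map_pmf fst ?W) (indicator V :: 'a \<Rightarrow> real)"
      by (rule integral_map_pmf[symmetric])
    then show ?thesis unfolding map_fst_increment_walk[OF supp] by simp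
  qed
  have eB: "exp (t * snd w) \<le> exp (2 * t * real n)" if "w \<in> set_pmf ?W" for w
    using tb[OF that] by simp
  have intI: "integrable (measure_pmf ?W) (\<lambda>w. indicator A (fst w) * exp (t * snd w) :: real)" for A
    by (rule integrable_pmf_bounded[where B = "exp (2 * t * real n)"])
       (use eB in \<open>auto simp: indicator_def\<close>)
  have 1: "integrable (measure_pmf ?W) (\<lambda>w. indicator V (fst w) :: real)"
    by (rule integrable_pmf_bounded[where B = 1]) (auto simp: indicator_def)
  have 2: "integrable (measure_pmf ?W) snd"
    by (rule integrable_pmf_bounded[OF bnd])
  \<comment> \<open>The integrand of the next expectation is \<open>1 - u + t f\<close>, with \<open>f\<close> the second component, on
    the event that the walk lies in \<open>V\<close>, and \<open>t f - u - 2 t n \<le> 0\<close> off this event.\<close>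
  have "1 - \<delta> \<le> (1 + 2 * t * real n) * (1 - \<delta>) - u + t * (real n * c) - 2 * t * real n"
  proof -
    have "t * real n * \<delta> \<le> t * real n * (c / 4)"
      using \<delta> t by (intro mult_left_mono) (auto simp: c_def)
    then show ?thesis by (simp add: u_def algebra_simps)
  qed
  also have "\<dots> \<le> (1 + 2 * t * real n) * measure (measure_pmf (convolution_power G \<eta> n)) V
      - u + t * (real n * c) - 2 * t * real n"
    using prob t by (intro diff_right_mono add_right_mono mult_left_mono) auto
  also have "\<dots> = measure_pmf.expectation ?W
      (\<lambda>w. (1 + 2 * t * real n) * indicator V (fst w) - u + t * snd w - 2 * t * real n)"
    using expectation_increment_walk[of n] 1 2 PV by (simp add: c_def)
  also have "\<dots> \<le> measure_pmf.expectation ?W (\<lambda>w. exp (- u) * (indicator V (fst w) * exp (t * snd w)))"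
  proof (rule integral_mono_AE)
    show "AE w in measure_pmf ?W. (1 + 2 * t * real n) * indicator V (fst w) - u + t * snd w
        - 2 * t * real n \<le> exp (- u) * (indicator V (fst w) * exp (t * snd w))"
    proof (simp add: AE_measure_pmf_iff, intro ballI)
      fix w assume w: "w \<in> set_pmf ?W"
      have "1 + (t * snd w - u) \<le> exp (t * snd w - u)" by (rule exp_ge_add_one_self)
      then show "(1 + 2 * t * real n) * indicator V (fst w) - u + t * snd w
        - 2 * t * real n \<le> exp (- u) * (indicator V (fst w) * exp (t * snd w))"
      proof (cases "fst w \<in> V")
        case True
        have "exp (t * snd w - u) = exp (- u) * exp (t * snd w)"
          by (simp add: exp_add[symmetric])
        then show ?thesis using \<open>1 + (t * snd w - u) \<le> exp (t * snd w - u)\<close> True by simp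
      next
        case False
        then show ?thesis using tb[OF w] u by (simp add: abs_le_iff)
      qed
    qed
  qed (use 1 2 intI in auto)
  also have "\<dots> = exp (- u) * measure_pmf.expectation ?W
      (\<lambda>w. \<Sum>v\<in>V. indicator {v} (fst w) * exp (t * snd w))"
  proof -
    have "indicator V y = (\<Sum>v\<in>V. indicator {v} y :: real)" for y
      using assms(1) by (simp add: indicator_def)
    then show ?thesis by (simp add: sum_distrib_right)
  qed
  also have "\<dots> = exp (- u) * (\<Sum>v\<in>V. measure_pmf.expectation ?W
      (\<lambda>w. indicator {v} (fst w) * exp (t * snd w)))"
    by (subst Bochner_Integration.integral_sum) (auto simp: intI)
  also have "\<dots> \<le> exp (- u) * (\<Sum>v\<in>V. exp (2 * t\<^sup>2 * real n))"
    using assms(2) t by (intro mult_left_mono sum_mono exponential_moment_increment_walk) auto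
  finally have "1 - \<delta> \<le> exp (- u) * (real (card V) * exp (2 * t\<^sup>2 * real n))" by simp
  then have "(1 - \<delta>) * exp (u - 2 * t\<^sup>2 * real n) \<le>
      exp (- u) * (real (card V) * exp (2 * t\<^sup>2 * real n)) * exp (u - 2 * t\<^sup>2 * real n)"
    by (rule mult_right_mono) simp
  also have "\<dots> = real (card V) * exp (- u + 2 * t\<^sup>2 * real n + (u - 2 * t\<^sup>2 * real n))"
    by (simp only: exp_add mult_ac)
  also have "\<dots> = real (card V)" by simp
  also have "u - 2 * t\<^sup>2 * real n = real n * c\<^sup>2 / 32"
    by (simp add: u_def t_def power2_eq_square)
  finally show ?thesis by (simp add: c_def)
qed

end

text \<open>
A nonconstant harmonic function takes different values at some \<open>x\<close> and \<open>x s\<close> with \<open>s\<close> in the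
support of \<open>\<eta>\<close>. Its translate by \<open>x\<close> then has positive variance under \<open>\<eta>\<close>, and the exponential
lower bound contradicts the hypothesis.
\<close>
lemma liouville_if_subexponential_concentration:
  assumes supp: "set_pmf \<eta> \<subseteq> carrier G" and gen: "generate G (set_pmf \<eta>) = carrier G"
    and conc: "\<And>\<epsilon> n0. \<epsilon> > 0 \<Longrightarrow> \<exists>n\<ge>n0. \<exists>V. finite V \<and> V \<subseteq> carrier G \<and>
          real (card V) \<le> exp (\<epsilon> * real n) \<and>
          measure (measure_pmf (convolution_power G \<eta> n)) V \<ge> 1 - \<epsilon>"
  shows "liouville G \<eta>"
  unfolding liouville_def
proof (intro allI impI)
  fix h :: "'a \<Rightarrow> real"
  assume "bounded (h ` carrier G) \<and> harmonic G \<eta> h"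
  then obtain M0 where M0: "\<And>x. x \<in> carrier G \<Longrightarrow> \<bar>h x\<bar> \<le> M0" and harm: "harmonic G \<eta> h"
    unfolding bounded_iff by auto
  define M where "M = max 1 M0"
  have M: "M > 0" "\<And>x. x \<in> carrier G \<Longrightarrow> \<bar>h x\<bar> \<le> M"
    using M0 by (auto simp: M_def intro: le_max_iff_disj[THEN iffD2])
  have hE: "measure_pmf.expectation \<eta> (\<lambda>s. h (x \<otimes> s)) = h x" if "x \<in> carrier G" for x
    using harm that supp unfolding harmonic_def by (intro expectation_eq_has_sum) auto
  have step: "h (x \<otimes> s) = h x" if x: "x \<in> carrier G" and s: "s \<in> set_pmf \<eta>" for x s
  proof (rule ccontr)
    assume ne: "h (x \<otimes> s) \<noteq> h x"
    define g where "g y = h (x \<otimes> y) / M" for y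
    define c where "c = measure_pmf.expectation \<eta> (\<lambda>s. (g s - g \<one>)\<^sup>2)"
    have g1: "\<bar>g y\<bar> \<le> 1" if "y \<in> carrier G" for y
      using M x that by (simp add: g_def)
    have gE: "measure_pmf.expectation \<eta> (\<lambda>s. g (y \<otimes> s)) = g y" if y: "y \<in> carrier G" for y
    proof -
      have "measure_pmf.expectation \<eta> (\<lambda>s. g (y \<otimes> s))
          = measure_pmf.expectation \<eta> (\<lambda>s. h ((x \<otimes> y) \<otimes> s) / M)"
        using supp x y by (intro expectation_cong_support) (auto simp: g_def m_assoc subset_eq)
      then show ?thesis using hE x y by (simp add: g_def)
    qed
    have int: "integrable (measure_pmf \<eta>) (\<lambda>s. (g s - g \<one>)\<^sup>2)"
    proof (rule integrable_pmf_bounded[where B = 4])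
      fix s assume "s \<in> set_pmf \<eta>"
      then have "\<bar>g s - g \<one>\<bar> \<le> 2" using g1[of s] g1[of \<one>] supp by (auto simp: abs_le_iff)
      from power_mono[OF this, of 2] show "\<bar>(g s - g \<one>)\<^sup>2\<bar> \<le> 4" by simp
    qed
    have "c \<noteq> 0"
    proof
      assume "c = 0"
      then have "AE s in measure_pmf \<eta>. (g s - g \<one>)\<^sup>2 = 0"
        unfolding c_def using integral_nonneg_eq_0_iff_AE[OF int] by simp
      then have "g s = g \<one>" using s by (auto simp: AE_measure_pmf_iff)
      then show False using ne M x s supp by (auto simp: g_def)
    qed
    moreover have "c \<ge> 0" unfolding c_def by (intro Bochner_Integration.integral_nonneg) simp
    ultimately have c: "c > 0" by simp
    \<comment> \<open>With \<open>\<epsilon> \<le> c\<^sup>2 / 64\<close> the allowed size \<open>exp(\<epsilon> n)\<close> is at most the square root of the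
      lower bound \<open>exp(n c\<^sup>2 / 32)\<close>. The times \<open>n > 64 / c\<^sup>2\<close> make this gap exceed the factor
      \<open>2\<close>, which is at least \<open>1 / (1 - \<epsilon>)\<close>.\<close>
    define \<epsilon> where "\<epsilon> = min (1/2) (min (c / 4) (c\<^sup>2 / 64))"
    have \<epsilon>: "\<epsilon> > 0" "\<epsilon> \<le> 1/2" "\<epsilon> \<le> c / 4" "\<epsilon> \<le> c\<^sup>2 / 64"
      using c by (auto simp: \<epsilon>_def min_def)
    obtain n V where n: "n \<ge> nat \<lceil>64 / c\<^sup>2\<rceil> + 1" and V: "finite V" "V \<subseteq> carrier G"
        "real (card V) \<le> exp (\<epsilon> * real n)"
        "measure (measure_pmf (convolution_power G \<eta> n)) V \<ge> 1 - \<epsilon>"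
      using conc[OF \<epsilon>(1)] by metis
    have n': "64 / c\<^sup>2 < real n"
      using n by linarith
    have "(1 - \<epsilon>) * exp (real n * c\<^sup>2 / 32) \<le> exp (\<epsilon> * real n)"
      using card_ge_exp_variance[OF supp g1 gE V(1,2,4)] \<epsilon>(3) c V(3) by (simp add: c_def)
    also have "\<dots> \<le> exp (real n * c\<^sup>2 / 64)"
      using mult_right_mono[OF \<epsilon>(4), of "real n"] by (simp add: mult_ac)
    finally have "(1 - \<epsilon>) * exp (real n * c\<^sup>2 / 32) \<le> exp (real n * c\<^sup>2 / 64)" .
    moreover have "1/2 * exp (real n * c\<^sup>2 / 32) \<le> (1 - \<epsilon>) * exp (real n * c\<^sup>2 / 32)"
      using \<epsilon>(2) by (intro mult_right_mono) auto
    moreover have "exp (real n * c\<^sup>2 / 32) = exp (real n * c\<^sup>2 / 64) * exp (real n * c\<^sup>2 / 64)"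
      by (simp add: exp_add[symmetric])
    ultimately have "exp (real n * c\<^sup>2 / 64) * exp (real n * c\<^sup>2 / 64) \<le> 2 * exp (real n * c\<^sup>2 / 64)"
      by linarith
    then have "exp (real n * c\<^sup>2 / 64) \<le> 2" by (simp only: mult_le_cancel_right_pos exp_gt_zero)
    moreover have "1 + real n * c\<^sup>2 / 64 \<le> exp (real n * c\<^sup>2 / 64)" by (rule exp_ge_add_one_self)
    moreover have "real n * c\<^sup>2 / 64 > 1" using n' c by (simp add: field_simps)
    ultimately show False by linarith
  qed
  have gstep: "h (x \<otimes> g) = h x" if "g \<in> generate G (set_pmf \<eta>)" "x \<in> carrier G" for g x
    using that
  proof (induction arbitrary: x rule: generate.induct)
    case (inv s)
    have s: "s \<in> carrier G" using inv supp by blast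
    have "h ((x \<otimes> inv s) \<otimes> s) = h (x \<otimes> inv s)" using step[OF _ inv.hyps] inv.prems s by simp
    then show ?case using inv.prems s by (simp add: m_assoc)
  next
    case (eng g1 g2)
    have g: "g1 \<in> carrier G" "g2 \<in> carrier G" using eng.hyps gen by auto
    then have "h (x \<otimes> (g1 \<otimes> g2)) = h ((x \<otimes> g1) \<otimes> g2)" using eng.prems by (simp add: m_assoc)
    also have "\<dots> = h x" using eng.IH(2)[of "x \<otimes> g1"] eng.IH(1)[of x] g eng.prems by simp
    finally show ?case .
  next
    case (incl s)
    then show ?case by (intro step) auto
  qed simp
  have "h x = h \<one>" if "x \<in> carrier G" for x
    using gstep[of x \<one>] that gen by simp
  then show "h constant_on carrier G"
    unfolding constant_on_def by blast
qed

end

section \<open>Displacement of finitely supported functions under translation\<close>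

definition right_shift :: "('a, 'b) monoid_scheme \<Rightarrow> 'a \<Rightarrow> ('a \<Rightarrow> real) \<Rightarrow> 'a \<Rightarrow> real" where
  "right_shift G y f = (\<lambda>x. f (x \<otimes>\<^bsub>G\<^esub> y))"

definition l2_inner :: "('a, 'b) monoid_scheme \<Rightarrow> ('a \<Rightarrow> real) \<Rightarrow> ('a \<Rightarrow> real) \<Rightarrow> real" where
  "l2_inner G f g = (\<Sum>\<^sub>\<infinity>x\<in>carrier G. f x * g x)"

definition finitely_supported :: "('a, 'b) monoid_scheme \<Rightarrow> ('a \<Rightarrow> real) \<Rightarrow> bool" where
  "finitely_supported G f \<longleftrightarrow> finite {x \<in> carrier G. f x \<noteq> 0}"

text \<open>
As translations are isometries of \<open>\<ell>\<^sup>2\<close>, this distance from \<open>f\<close> to its translate is a symmetric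
subadditive function of \<open>y\<close>, which is why it grows at most linearly with the word length.
\<close>
definition displacement :: "('a, 'b) monoid_scheme \<Rightarrow> ('a \<Rightarrow> real) \<Rightarrow> 'a \<Rightarrow> real" where
  "displacement G f y = sqrt (l2_inner G (\<lambda>x. f x - right_shift G y f x) (\<lambda>x. f x - right_shift G y f x))"

definition unit_bump :: "('a, 'b) monoid_scheme \<Rightarrow> 'a set \<Rightarrow> ('a \<Rightarrow> real) \<Rightarrow> bool" where
  "unit_bump G U \<phi> \<longleftrightarrow> finite U \<and> U \<subseteq> carrier G \<and> (\<forall>x. \<phi> x \<ge> 0) \<and>
     (\<forall>x\<in>carrier G - U. \<phi> x = 0) \<and> (\<Sum>x\<in>U. (\<phi> x)\<^sup>2) = 1"

text \<open>
All \<open>\<ell>\<^sup>2\<close>-computations concern finitely supported functions and are carried out as finite sums.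
The inner product is still defined as a sum over the whole group, to have its translation
invariance for free.
\<close>
lemma l2_inner_finite_sum:
  assumes "finite A" "A \<subseteq> carrier G" "\<And>x. x \<in> carrier G - A \<Longrightarrow> f x * g x = 0"
  shows "l2_inner G f g = (\<Sum>x\<in>A. f x * g x)"
proof -
  have "l2_inner G f g = infsum (\<lambda>x. f x * g x) A"
    unfolding l2_inner_def using assms by (intro infsum_cong_neutral) auto
  then show ?thesis using assms(1) by simp
qed

lemma l2_inner_commute: "l2_inner G f g = l2_inner G g f"
  by (simp add: l2_inner_def mult.commute)

lemma l2_inner_add_right:
  assumes "finitely_supported G f"
  shows "l2_inner G f (\<lambda>x. g x + h x) = l2_inner G f g + l2_inner G f h"
proof -
  have "l2_inner G f k = (\<Sum>x\<in>{x \<in> carrier G. f x \<noteq> 0}. f x * k x)" for k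
    using assms by (intro l2_inner_finite_sum) (auto simp: finitely_supported_def)
  then show ?thesis by (simp add: algebra_simps sum.distrib)
qed

lemma l2_inner_diff_right:
  assumes "finitely_supported G f"
  shows "l2_inner G f (\<lambda>x. g x - h x) = l2_inner G f g - l2_inner G f h"
proof -
  have "l2_inner G f k = (\<Sum>x\<in>{x \<in> carrier G. f x \<noteq> 0}. f x * k x)" for k
    using assms by (intro l2_inner_finite_sum) (auto simp: finitely_supported_def)
  then show ?thesis by (simp add: algebra_simps sum_subtractf)
qed

lemma l2_inner_add_left:
  assumes "finitely_supported G f" "finitely_supported G g"
  shows "l2_inner G (\<lambda>x. f x + g x) h = l2_inner G f h + l2_inner G g h"
proof -
  let ?A = "{x \<in> carrier G. f x \<noteq> 0} \<union> {x \<in> carrier G. g x \<noteq> 0}"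
  have A: "finite ?A" using assms by (simp add: finitely_supported_def)
  have "l2_inner G k h = (\<Sum>x\<in>?A. k x * h x)" if "\<And>x. x \<in> carrier G - ?A \<Longrightarrow> k x = 0" for k
    using A that by (intro l2_inner_finite_sum) auto
  note this[of f] this[of g] this[of "\<lambda>x. f x + g x"]
  then show ?thesis by (simp add: algebra_simps sum.distrib)
qed

lemma l2_inner_cong:
  assumes "\<And>x. x \<in> carrier G \<Longrightarrow> f x = f' x" "\<And>x. x \<in> carrier G \<Longrightarrow> g x = g' x"
  shows "l2_inner G f g = l2_inner G f' g'"
  unfolding l2_inner_def using assms by (intro infsum_cong) simp

lemma l2_inner_self_nonneg: "l2_inner G f f \<ge> 0"
  unfolding l2_inner_def by (intro infsum_nonneg) simp

lemma finitely_supported_add: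
  "finitely_supported G f \<Longrightarrow> finitely_supported G g \<Longrightarrow>
    finitely_supported G (\<lambda>x. f x + g x)"
  unfolding finitely_supported_def
  by (rule finite_subset[of _ "{x \<in> carrier G. f x \<noteq> 0} \<union> {x \<in> carrier G. g x \<noteq> 0}"]) auto

lemma finitely_supported_diff:
  "finitely_supported G f \<Longrightarrow> finitely_supported G g \<Longrightarrow>
    finitely_supported G (\<lambda>x. f x - g x)"
  unfolding finitely_supported_def
  by (rule finite_subset[of _ "{x \<in> carrier G. f x \<noteq> 0} \<union> {x \<in> carrier G. g x \<noteq> 0}"]) auto

lemma l2_norm_triangle:
  assumes "finitely_supported G f" "finitely_supported G g"
  shows "sqrt (l2_inner G (\<lambda>x. f x + g x) (\<lambda>x. f x + g x)) \<le> sqrt (l2_inner G f f) + sqrt (l2_inner G g g)"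
proof -
  let ?A = "{x \<in> carrier G. f x \<noteq> 0} \<union> {x \<in> carrier G. g x \<noteq> 0}"
  have A: "finite ?A" using assms by (simp add: finitely_supported_def)
  have eq: "sqrt (l2_inner G h h) = L2_set h ?A" if "\<And>x. x \<in> carrier G - ?A \<Longrightarrow> h x = 0" for h
    unfolding L2_set_def using A that by (subst l2_inner_finite_sum[where A = ?A]) (auto simp: power2_eq_square)
  show ?thesis
    by (subst (1 2 3) eq) (auto intro: L2_set_triangle_ineq)
qed

lemma displacement_nonneg: "displacement G f y \<ge> 0"
  by (simp add: displacement_def l2_inner_self_nonneg)

context group begin

lemma bij_betw_mult_right:
  assumes "y \<in> carrier G"
  shows "bij_betw (\<lambda>x. x \<otimes> y) (carrier G) (carrier G)"
  by (rule bij_betw_byWitness[where f' = "\<lambda>x. x \<otimes> inv y"]) (use assms in \<open>auto simp: m_assoc\<close>)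

lemma l2_inner_shift:
  assumes "y \<in> carrier G"
  shows "l2_inner G (right_shift G y f) (right_shift G y g) = l2_inner G f g"
  unfolding l2_inner_def right_shift_def
  using infsum_reindex_bij_betw[OF bij_betw_mult_right[OF assms], of "\<lambda>x. f x * g x"] .

lemma finitely_supported_shift:
  assumes "y \<in> carrier G" "finitely_supported G f"
  shows "finitely_supported G (right_shift G y f)"
proof -
  have "{x \<in> carrier G. right_shift G y f x \<noteq> 0} \<subseteq> (\<lambda>x. x \<otimes> inv y) ` {x \<in> carrier G. f x \<noteq> 0}"
  proof
    fix x assume "x \<in> {x \<in> carrier G. right_shift G y f x \<noteq> 0}"
    then have "x \<in> carrier G" "f (x \<otimes> y) \<noteq> 0" by (auto simp: right_shift_def)
    moreover have "x = (x \<otimes> y) \<otimes> inv y" using \<open>x \<in> carrier G\<close> assms(1) by (simp add: m_assoc)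
    ultimately show "x \<in> (\<lambda>x. x \<otimes> inv y) ` {x \<in> carrier G. f x \<noteq> 0}"
      using assms(1) by blast
  qed
  then show ?thesis
    using assms(2) unfolding finitely_supported_def by (meson finite_imageI finite_subset)
qed

lemma displacement_sq:
  assumes "y \<in> carrier G" "finitely_supported G f"
  shows "(displacement G f y)\<^sup>2 = 2 * l2_inner G f f - 2 * l2_inner G f (right_shift G y f)"
proof -
  let ?s = "right_shift G y f"
  note fs = assms(2) finitely_supported_shift[OF assms]
  have "(displacement G f y)\<^sup>2 = l2_inner G (\<lambda>x. f x - ?s x) (\<lambda>x. f x - ?s x)"
    by (simp add: displacement_def l2_inner_self_nonneg)
  also have "\<dots> = l2_inner G (\<lambda>x. f x - ?s x) f - l2_inner G (\<lambda>x. f x - ?s x) ?s"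
    by (rule l2_inner_diff_right[OF finitely_supported_diff[OF fs]])
  also have "\<dots> = (l2_inner G f f - l2_inner G f ?s) - (l2_inner G ?s f - l2_inner G ?s ?s)"
    using l2_inner_diff_right[OF fs(1), of f ?s] l2_inner_diff_right[OF fs(2), of f ?s]
    by (simp add: l2_inner_commute[of G "\<lambda>x. f x - ?s x"])
  finally show ?thesis
    using l2_inner_shift[OF assms(1), of f f] l2_inner_commute[of G ?s f] by simp
qed

lemma displacement_one: "displacement G f \<one> = 0"
proof -
  have "l2_inner G (\<lambda>x. f x - right_shift G \<one> f x) (\<lambda>x. f x - right_shift G \<one> f x) = l2_inner G (\<lambda>_. 0) (\<lambda>_. 0)"
    by (rule l2_inner_cong) (auto simp: right_shift_def)
  then show ?thesis by (simp add: displacement_def l2_inner_def)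
qed

lemma displacement_inv:
  assumes "y \<in> carrier G"
  shows "displacement G f (inv y) = displacement G f y"
proof -
  let ?d = "\<lambda>x. f x - right_shift G (inv y) f x"
  let ?e = "\<lambda>x. f x - right_shift G y f x"
  have sd: "right_shift G y ?d x = - ?e x" if "x \<in> carrier G" for x
    using assms that by (simp add: right_shift_def m_assoc)
  have "l2_inner G ?d ?d = l2_inner G (right_shift G y ?d) (right_shift G y ?d)"
    by (rule l2_inner_shift[OF assms, symmetric])
  also have "\<dots> = l2_inner G (\<lambda>x. - ?e x) (\<lambda>x. - ?e x)"
    by (intro l2_inner_cong sd)
  also have "\<dots> = l2_inner G ?e ?e"
    by (simp add: l2_inner_def algebra_simps)
  finally show ?thesis by (simp add: displacement_def)
qed

lemma displacement_mult:
  assumes "y \<in> carrier G" "z \<in> carrier G" "finitely_supported G f"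
  shows "displacement G f (y \<otimes> z) \<le> displacement G f y + displacement G f z"
proof -
  let ?d = "\<lambda>x. f x - right_shift G y f x"
  let ?e = "\<lambda>x. f x - right_shift G z f x"
  have "l2_inner G (\<lambda>x. f x - right_shift G (y \<otimes> z) f x) (\<lambda>x. f x - right_shift G (y \<otimes> z) f x)
      = l2_inner G (\<lambda>x. ?d x + right_shift G y ?e x) (\<lambda>x. ?d x + right_shift G y ?e x)"
    using assms(1,2) by (intro l2_inner_cong) (auto simp: right_shift_def m_assoc)
  moreover have "sqrt (l2_inner G (\<lambda>x. ?d x + right_shift G y ?e x) (\<lambda>x. ?d x + right_shift G y ?e x))
      \<le> sqrt (l2_inner G ?d ?d) + sqrt (l2_inner G (right_shift G y ?e) (right_shift G y ?e))"
    using assms by (intro l2_norm_triangle finitely_supported_shift finitely_supported_diff) auto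
  ultimately show ?thesis
    by (simp add: displacement_def l2_inner_shift[OF assms(1)])
qed

lemma foldr_mult:
  assumes "set u \<subseteq> carrier G" "y \<in> carrier G"
  shows "foldr (\<lambda>x y. x \<otimes> y) u y = foldr (\<lambda>x y. x \<otimes> y) u \<one> \<otimes> y \<and>
    foldr (\<lambda>x y. x \<otimes> y) u \<one> \<in> carrier G"
  using assms by (induction u) (auto simp: m_assoc)

lemma generate_imp_word:
  assumes "S \<subseteq> carrier G" "g \<in> generate G S"
  shows "\<exists>ws. set ws \<subseteq> S \<union> m_inv G ` S \<and> foldr (\<lambda>x y. x \<otimes> y) ws \<one> = g"
  using assms(2)
proof (induction rule: generate.induct)
  case one
  show ?case by (intro exI[of _ "[]"]) simp
next
  case (incl h)
  then show ?case using assms(1) by (intro exI[of _ "[h]"]) auto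
next
  case (inv h)
  then show ?case using assms(1) by (intro exI[of _ "[inv h]"]) auto
next
  case (eng g1 g2)
  then obtain u v where u: "set u \<subseteq> S \<union> m_inv G ` S" "foldr (\<lambda>x y. x \<otimes> y) u \<one> = g1"
    and v: "set v \<subseteq> S \<union> m_inv G ` S" "foldr (\<lambda>x y. x \<otimes> y) v \<one> = g2" by blast
  have g2: "g2 \<in> carrier G"
    using eng.hyps(2) generate_in_carrier[OF assms(1)] by blast
  have "set u \<subseteq> carrier G" using u(1) assms(1) by auto
  then have "foldr (\<lambda>x y. x \<otimes> y) (u @ v) \<one> = g1 \<otimes> g2"
    using foldr_mult[of u g2] g2 u(2) v(2) by simp
  then show ?case using u(1) v(1) by (intro exI[of _ "u @ v"]) auto
qed

text \<open>
Used twice: for the displacement with respect to the given generating set, and with respect to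
the support of \<open>\<mu>\<close>, in order to compare the two.
\<close>
lemma subadditive_le_word_length:
  fixes \<rho> :: "'a \<Rightarrow> real"
  assumes S: "S \<subseteq> carrier G" "generate G S = carrier G"
    and \<rho>: "\<rho> \<one> = 0" "\<And>x. x \<in> carrier G \<Longrightarrow> \<rho> (inv x) = \<rho> x"
      "\<And>x y. x \<in> carrier G \<Longrightarrow> y \<in> carrier G \<Longrightarrow> \<rho> (x \<otimes> y) \<le> \<rho> x + \<rho> y"
    and D: "\<And>s. s \<in> S \<Longrightarrow> \<rho> s \<le> D"
    and g: "g \<in> carrier G"
  shows "\<rho> g \<le> D * real (word_length G S g)"
proof -
  have word: "foldr (\<lambda>x y. x \<otimes> y) ws \<one> \<in> carrier G
      \<and> \<rho> (foldr (\<lambda>x y. x \<otimes> y) ws \<one>) \<le> D * real (length ws)"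
    if "set ws \<subseteq> S \<union> m_inv G ` S" for ws
    using that
  proof (induction ws)
    case (Cons a ws)
    then have a: "a \<in> carrier G" "\<rho> a \<le> D" using S(1) \<rho>(2) D by auto
    moreover have IH: "foldr (\<lambda>x y. x \<otimes> y) ws \<one> \<in> carrier G"
        "\<rho> (foldr (\<lambda>x y. x \<otimes> y) ws \<one>) \<le> D * real (length ws)"
      using Cons by auto
    ultimately show ?case
      using \<rho>(3)[OF a(1) IH(1)] by (simp add: algebra_simps)
  qed (simp add: \<rho>)
  have "\<exists>n ws. length ws = n \<and> set ws \<subseteq> S \<union> m_inv G ` S \<and> foldr (\<lambda>x y. x \<otimes> y) ws \<one> = g"
    using generate_imp_word[OF S(1), of g] S(2) g by blast
  from LeastI_ex[OF this] obtain ws where "length ws = word_length G S g"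
      "set ws \<subseteq> S \<union> m_inv G ` S" "foldr (\<lambda>x y. x \<otimes> y) ws \<one> = g"
    unfolding word_length_def by blast
  then show ?thesis using word[of ws] by simp
qed

lemma displacement_le_word_length:
  assumes "S \<subseteq> carrier G" "generate G S = carrier G" "finitely_supported G f"
    and "\<And>s. s \<in> S \<Longrightarrow> displacement G f s \<le> D" "g \<in> carrier G"
  shows "displacement G f g \<le> D * real (word_length G S g)"
  by (rule subadditive_le_word_length[OF assms(1,2)])
     (use assms displacement_one displacement_inv displacement_mult in auto)

end

section \<open>Overlaps of a function with its translates confine the walk\<close>

context group begin

context
  fixes \<phi> :: "'a \<Rightarrow> real" and U :: "'a set"
  assumes bump: "unit_bump G U \<phi>"
begin

private lemma U: "finite U" "U \<subseteq> carrier G"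
  and \<phi>_nonneg: "\<phi> x \<ge> 0"
  and \<phi>_zero: "x \<in> carrier G - U \<Longrightarrow> \<phi> x = 0"
  and \<phi>_unit: "(\<Sum>x\<in>U. (\<phi> x)\<^sup>2) = 1"
  using bump by (auto simp: unit_bump_def)

abbreviation "overlap \<equiv> \<lambda>y. \<Sum>x\<in>U. \<phi> x * \<phi> (x \<otimes> y)"

lemma finitely_supported_bump: "finitely_supported G \<phi>"
  unfolding finitely_supported_def by (rule finite_subset[OF _ U(1)]) (use \<phi>_zero in auto)

lemma overlap_nonneg: "overlap y \<ge> 0"
  by (intro sum_nonneg mult_nonneg_nonneg \<phi>_nonneg)

lemma overlap_eq_displacement:
  assumes "y \<in> carrier G"
  shows "1 - overlap y = (displacement G \<phi> y)\<^sup>2 / 2"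
proof -
  have "l2_inner G \<phi> \<phi> = 1"
    using U \<phi>_zero \<phi>_unit by (subst l2_inner_finite_sum[of U]) (auto simp: power2_eq_square)
  moreover have "l2_inner G \<phi> (right_shift G y \<phi>) = overlap y"
    using U \<phi>_zero by (subst l2_inner_finite_sum[of U]) (auto simp: right_shift_def)
  ultimately show ?thesis
    using displacement_sq[OF assms finitely_supported_bump] by simp
qed

lemma overlap_le_one:
  assumes "y \<in> carrier G"
  shows "overlap y \<le> 1"
  using overlap_eq_displacement[OF assms] zero_le_power2[of "displacement G \<phi> y"] by linarith

lemma overlap_eq_zero:
  assumes "y \<in> carrier G" "y \<notin> (\<lambda>(x, z). inv x \<otimes> z) ` (U \<times> U)"
  shows "overlap y = 0"
proof (rule sum.neutral, rule ballI)
  fix x assume x: "x \<in> U"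
  have "x \<otimes> y \<notin> U"
  proof
    assume "x \<otimes> y \<in> U"
    moreover have "y = inv x \<otimes> (x \<otimes> y)" using x U assms(1) by (auto simp: m_assoc[symmetric])
    ultimately show False using assms(2) x by force
  qed
  then show "\<phi> x * \<phi> (x \<otimes> y) = 0"
    using \<phi>_zero x U assms(1) by auto
qed

text \<open>
The right-hand side is \<open>\<langle>R\<^sub>y \<phi>, R\<^sub>z \<phi>\<rangle>\<close> by translation invariance. On the left this inner product
is cut down to \<open>U\<close>, which can only decrease it because \<open>\<phi> \<ge> 0\<close>. The cut keeps everything below a
finite sum, although the support of \<open>\<nu>\<close> may be infinite.
\<close>
lemma overlap_translates_le:
  assumes "y \<in> carrier G" "z \<in> carrier G"
  shows "(\<Sum>x\<in>U. \<phi> (x \<otimes> y) * \<phi> (x \<otimes> z)) \<le> overlap (inv y \<otimes> z)"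
proof -
  let ?B = "{x \<in> U. x \<otimes> y \<in> U}"
  have "(\<Sum>x\<in>U. \<phi> (x \<otimes> y) * \<phi> (x \<otimes> z)) = (\<Sum>x\<in>?B. \<phi> (x \<otimes> y) * \<phi> (x \<otimes> z))"
    using U \<phi>_zero assms(1) by (intro sum.mono_neutral_right) auto
  also have "\<dots> = (\<Sum>x\<in>?B. \<phi> (x \<otimes> y) * \<phi> ((x \<otimes> y) \<otimes> (inv y \<otimes> z)))"
  proof (intro sum.cong refl)
    fix x assume "x \<in> ?B"
    then have x: "x \<in> carrier G" using U by auto
    have "y \<otimes> (inv y \<otimes> z) = z" using assms by (simp add: m_assoc[symmetric])
    then show "\<phi> (x \<otimes> y) * \<phi> (x \<otimes> z) = \<phi> (x \<otimes> y) * \<phi> ((x \<otimes> y) \<otimes> (inv y \<otimes> z))"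
      using x assms by (simp add: m_assoc)
  qed
  also have "\<dots> = (\<Sum>x\<in>(\<lambda>x. x \<otimes> y) ` ?B. \<phi> x * \<phi> (x \<otimes> (inv y \<otimes> z)))"
    using U assms(1) by (subst sum.reindex) (auto intro!: inj_onI simp: subset_eq)
  also have "\<dots> \<le> overlap (inv y \<otimes> z)"
    using U by (intro sum_mono2) (auto intro!: mult_nonneg_nonneg \<phi>_nonneg)
  finally show ?thesis .
qed

private lemma \<phi>_le_one: "x \<in> carrier G \<Longrightarrow> \<phi> x \<le> 1"
proof -
  assume x: "x \<in> carrier G"
  show ?thesis
  proof (cases "x \<in> U")
    case True
    then have "(\<phi> x)\<^sup>2 \<le> 1"
      using member_le_sum[of x U "\<lambda>x. (\<phi> x)\<^sup>2"] U \<phi>_unit by simp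
    then show ?thesis by (simp add: power2_le_iff_abs_le abs_le_iff abs_square_le_1)
  qed (use \<phi>_zero x in simp)
qed

text \<open>
With \<open>P\<close> the Markov operator of \<open>\<nu>\<close>, this is \<open>\<langle>\<phi>, P \<phi>\<rangle>\<^sup>2 \<le> \<parallel>P \<phi>\<parallel>\<^sup>2 = \<langle>\<phi>, P\<^sup>2 \<phi>\<rangle>\<close>: the
Cauchy-Schwarz inequality and self-adjointness.
\<close>
lemma overlap_square:
  assumes \<nu>: "set_pmf \<nu> \<subseteq> carrier G" "map_pmf (m_inv G) \<nu> = \<nu>"
  shows "(measure_pmf.expectation \<nu> overlap)\<^sup>2
      \<le> measure_pmf.expectation (convolution_pmf G \<nu> \<nu>) overlap"
proof -
  let ?E = "measure_pmf.expectation \<nu>"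
  have oB: "\<bar>overlap y\<bar> \<le> 1" if "y \<in> carrier G" for y
    using overlap_le_one[OF that] overlap_nonneg[of y] by simp
  have \<phi>B: "\<bar>\<phi> (x \<otimes> y)\<bar> \<le> 1" if "x \<in> U" "y \<in> set_pmf \<nu>" for x y
    using \<phi>_le_one[of "x \<otimes> y"] \<phi>_nonneg[of "x \<otimes> y"] that U \<nu>(1) by auto
  have int: "integrable (measure_pmf \<nu>) (\<lambda>y. \<phi> (x \<otimes> y))" if "x \<in> U" for x
    by (rule integrable_pmf_bounded[OF \<phi>B[OF that]])
  have tB: "\<bar>\<Sum>x\<in>U. \<phi> (x \<otimes> y) * \<phi> (x \<otimes> z)\<bar> \<le> 1" if "y \<in> set_pmf \<nu>" "z \<in> set_pmf \<nu>" for y z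
  proof -
    have "(\<Sum>x\<in>U. \<phi> (x \<otimes> y) * \<phi> (x \<otimes> z)) \<le> overlap (inv y \<otimes> z)"
      using that \<nu>(1) by (intro overlap_translates_le) auto
    also have "\<dots> \<le> 1" using that \<nu>(1) by (intro overlap_le_one) auto
    finally show ?thesis
      by (simp add: sum_nonneg \<phi>_nonneg)
  qed
  have "(?E overlap)\<^sup>2 = (\<Sum>x\<in>U. \<phi> x * ?E (\<lambda>y. \<phi> (x \<otimes> y)))\<^sup>2"
    using int by (subst Bochner_Integration.integral_sum) auto
  also have "\<dots> \<le> (\<Sum>x\<in>U. (\<phi> x)\<^sup>2) * (\<Sum>x\<in>U. (?E (\<lambda>y. \<phi> (x \<otimes> y)))\<^sup>2)"
    by (rule Cauchy_Schwarz_ineq_sum)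
  also have "\<dots> = (\<Sum>x\<in>U. ?E (\<lambda>y. \<phi> (x \<otimes> y) * ?E (\<lambda>z. \<phi> (x \<otimes> z))))"
    using \<phi>_unit by (simp add: power2_eq_square)
  also have "\<dots> = ?E (\<lambda>y. \<Sum>x\<in>U. \<phi> (x \<otimes> y) * ?E (\<lambda>z. \<phi> (x \<otimes> z)))"
    using int by (subst Bochner_Integration.integral_sum) auto
  also have "\<dots> = ?E (\<lambda>y. ?E (\<lambda>z. \<Sum>x\<in>U. \<phi> (x \<otimes> y) * \<phi> (x \<otimes> z)))"
    using int by (subst Bochner_Integration.integral_sum) auto
  also have "\<dots> \<le> ?E (\<lambda>y. ?E (\<lambda>z. overlap (inv y \<otimes> z)))"
  proof (rule expectation_mono_bounded[where A = 1 and B = 1])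
    fix y assume y: "y \<in> set_pmf \<nu>"
    then have yG: "y \<in> carrier G" using \<nu>(1) by blast
    show "?E (\<lambda>z. \<Sum>x\<in>U. \<phi> (x \<otimes> y) * \<phi> (x \<otimes> z)) \<le> ?E (\<lambda>z. overlap (inv y \<otimes> z))"
      by (rule expectation_mono_bounded[where A = 1 and B = 1])
         (use yG y \<nu>(1) in \<open>auto intro!: overlap_translates_le tB oB\<close>)
    show "\<bar>?E (\<lambda>z. \<Sum>x\<in>U. \<phi> (x \<otimes> y) * \<phi> (x \<otimes> z))\<bar> \<le> 1"
      by (intro abs_expectation_le tB[OF y])
    show "\<bar>?E (\<lambda>z. overlap (inv y \<otimes> z))\<bar> \<le> 1"
      using yG \<nu>(1) by (intro abs_expectation_le oB) auto
  qed
  \<comment> \<open>Symmetry of \<open>\<nu>\<close> removes the inverse.\<close>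
  also have "\<dots> = measure_pmf.expectation (map_pmf (m_inv G) \<nu>) (\<lambda>y. ?E (\<lambda>z. overlap (y \<otimes> z)))"
    by simp
  also have "\<dots> = ?E (\<lambda>y. ?E (\<lambda>z. overlap (y \<otimes> z)))"
    unfolding \<nu>(2) ..
  also have "\<dots> = measure_pmf.expectation (convolution_pmf G \<nu> \<nu>) overlap"
    unfolding convolution_pmf_bind
    using \<nu>(1) by (subst expectation_bind_pmf[where B = 1]) (auto intro!: oB)
  finally show ?thesis .
qed

lemma overlap_dyadic_power:
  assumes \<eta>: "set_pmf \<eta> \<subseteq> carrier G" "symmetric_pmf G \<eta>"
  shows "(measure_pmf.expectation \<eta> overlap) ^ (2 ^ j)
      \<le> measure_pmf.expectation (convolution_power G \<eta> (2 ^ j)) overlap"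
proof (induction j)
  case 0
  then show ?case using \<eta> by (simp add: convolution_one_left)
next
  case (Suc j)
  let ?P = "convolution_power G \<eta> (2 ^ j)"
  have "0 \<le> measure_pmf.expectation \<eta> overlap"
    by (intro Bochner_Integration.integral_nonneg overlap_nonneg)
  then have "(measure_pmf.expectation \<eta> overlap) ^ (2 ^ Suc j) \<le> (measure_pmf.expectation ?P overlap)\<^sup>2"
    using power_mono[OF Suc, of 2] by (simp add: power_mult[symmetric] mult.commute)
  also have "\<dots> \<le> measure_pmf.expectation (convolution_pmf G ?P ?P) overlap"
    using \<eta> by (intro overlap_square convolution_power_support map_inv_convolution_power)
  also have "convolution_pmf G ?P ?P = convolution_power G \<eta> (2 ^ Suc j)"
    using convolution_power_add[OF \<eta>(1), of "2 ^ j" "2 ^ j"] by (simp add: mult_2)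
  finally show ?case .
qed

text \<open>
The overlap is dominated by the indicator function of \<open>U\<inverse> U\<close>. Its mean after \<open>2\<^sup>j\<close> steps is at
least \<open>(1 - \<theta>)\<close> to the power \<open>2\<^sup>j\<close>, and Bernoulli's inequality linearises this.
\<close>
lemma prob_quotient_set_ge:
  assumes \<eta>: "set_pmf \<eta> \<subseteq> carrier G" "symmetric_pmf G \<eta>"
    and lam: "measure_pmf.expectation \<eta> (\<lambda>y. 1 - overlap y) \<le> \<theta>"
  shows "1 - real (2 ^ j) * \<theta>
    \<le> measure (measure_pmf (convolution_power G \<eta> (2 ^ j))) ((\<lambda>(x, z). inv x \<otimes> z) ` (U \<times> U))"
proof -
  let ?P = "convolution_power G \<eta> (2 ^ j)" and ?V = "(\<lambda>(x, z). inv x \<otimes> z) ` (U \<times> U)"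
  let ?e = "measure_pmf.expectation \<eta> overlap"
  have oB: "\<bar>overlap y\<bar> \<le> 1" if "y \<in> carrier G" for y
    using overlap_le_one[OF that] overlap_nonneg[of y] by simp
  have "integrable (measure_pmf \<eta>) overlap"
    by (rule integrable_pmf_bounded[where B = 1]) (use \<eta>(1) oB in auto)
  then have e: "1 - \<theta> \<le> ?e" using lam by simp
  have e0: "0 \<le> ?e" by (intro Bochner_Integration.integral_nonneg overlap_nonneg)
  have "1 - real (2 ^ j) * \<theta> \<le> 1 + real (2 ^ j) * (?e - 1)"
    using mult_left_mono[OF e, of "real (2 ^ j)"] by (simp add: algebra_simps)
  also have "\<dots> \<le> (1 + (?e - 1)) ^ (2 ^ j)"
    using e0 by (intro Bernoulli_inequality) simp
  also have "\<dots> \<le> measure_pmf.expectation ?P overlap"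
    using overlap_dyadic_power[OF \<eta>] by simp
  also have "\<dots> \<le> measure_pmf.expectation ?P (indicator ?V)"
  proof (rule expectation_mono_bounded[where A = 1 and B = 1])
    fix y assume "y \<in> set_pmf ?P"
    then have y: "y \<in> carrier G" using convolution_power_support[OF \<eta>(1)] by blast
    show "overlap y \<le> indicator ?V y"
      using overlap_le_one[OF y] overlap_eq_zero[OF y] by (auto simp: indicator_def)
    show "\<bar>overlap y\<bar> \<le> 1" by (rule oB[OF y])
  qed (simp add: indicator_def)
  finally show ?thesis by simp
qed

end

end

section \<open>Slow decay of return probabilities yields almost invariant functions\<close>

declare convolution_power.simps(2) [simp del]

context group begin

lemma pmf_map_mult_left:
  assumes "set_pmf \<nu> \<subseteq> carrier G" "x \<in> carrier G" "z \<in> carrier G"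
  shows "pmf (map_pmf (\<lambda>y. x \<otimes> y) \<nu>) z = pmf \<nu> (inv x \<otimes> z)"
proof -
  have "(\<lambda>y. x \<otimes> y) -` {z} \<inter> set_pmf \<nu> = {inv x \<otimes> z} \<inter> set_pmf \<nu>"
    using assms by (auto simp: m_assoc[symmetric])
  then have "measure (measure_pmf \<nu>) ((\<lambda>y. x \<otimes> y) -` {z}) = measure (measure_pmf \<nu>) {inv x \<otimes> z}"
    by (metis measure_Int_set_pmf)
  then show ?thesis by (simp add: pmf_map measure_pmf_single)
qed

lemma pmf_convolution:
  assumes "set_pmf \<mu> \<subseteq> carrier G" "set_pmf \<nu> \<subseteq> carrier G" "finite (set_pmf \<mu>)" "z \<in> carrier G"
  shows "pmf (convolution_pmf G \<mu> \<nu>) z = (\<Sum>x\<in>set_pmf \<mu>. pmf \<mu> x * pmf \<nu> (inv x \<otimes> z))"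
proof -
  have "pmf (convolution_pmf G \<mu> \<nu>) z = measure_pmf.expectation \<mu> (\<lambda>x. pmf \<nu> (inv x \<otimes> z))"
    unfolding convolution_pmf_bind pmf_bind
    using assms by (intro expectation_cong_support pmf_map_mult_left) auto
  also have "\<dots> = (\<Sum>x\<in>set_pmf \<mu>. pmf \<nu> (inv x \<otimes> z) * pmf \<mu> x)"
    using assms(3) by (intro integral_measure_pmf_real) auto
  finally show ?thesis by (simp add: mult.commute)
qed

lemma pmf_inv_eq:
  assumes "set_pmf \<nu> \<subseteq> carrier G" "map_pmf (m_inv G) \<nu> = \<nu>" "x \<in> carrier G"
  shows "pmf \<nu> (inv x) = pmf \<nu> x"
proof -
  have "m_inv G -` {inv x} \<inter> set_pmf \<nu> = {x} \<inter> set_pmf \<nu>"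
    using assms(1,3) by (auto dest: inv_inj[THEN inj_onD])
  then have "measure (measure_pmf \<nu>) (m_inv G -` {inv x}) = measure (measure_pmf \<nu>) {x}"
    by (metis measure_Int_set_pmf)
  then have "pmf (map_pmf (m_inv G) \<nu>) (inv x) = pmf \<nu> x"
    by (simp add: pmf_map measure_pmf_single)
  then show ?thesis using assms(2) by simp
qed

context
  fixes \<mu> :: "'a pmf"
  assumes \<mu>: "set_pmf \<mu> \<subseteq> carrier G" "symmetric_pmf G \<mu>" "finite (set_pmf \<mu>)"
begin

abbreviation "walk_law n \<equiv> pmf (convolution_power G \<mu> n)"

abbreviation "return_prob n \<equiv> walk_law n \<one>"

lemmas walk_law_support = convolution_power_support[OF \<mu>(1)]

lemma walk_law_inv: "x \<in> carrier G \<Longrightarrow> walk_law n (inv x) = walk_law n x"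
  by (rule pmf_inv_eq[OF walk_law_support map_inv_convolution_power[OF \<mu>(1,2)]])

lemma finite_walk_law_support: "finite (set_pmf (convolution_power G \<mu> n))"
  by (induction n) (simp_all add: convolution_power.simps(2) convolution_pmf_def \<mu>(3))

lemma finitely_supported_walk_law: "finitely_supported G (walk_law n)"
  unfolding finitely_supported_def
  by (rule finite_subset[OF _ finite_walk_law_support[of n]]) (auto simp: set_pmf_iff)

lemma l2_inner_walk_law: "l2_inner G (walk_law m) (walk_law n) = return_prob (m + n)"
proof -
  let ?A = "set_pmf (convolution_power G \<mu> m)"
  have "l2_inner G (walk_law m) (walk_law n) = (\<Sum>x\<in>?A. walk_law m x * walk_law n x)"
    using walk_law_support finite_walk_law_support by (intro l2_inner_finite_sum) (auto simp: set_pmf_iff)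
  also have "\<dots> = (\<Sum>x\<in>?A. walk_law m x * walk_law n (inv x \<otimes> \<one>))"
    using walk_law_support[of m] walk_law_inv by (intro sum.cong) auto
  also have "\<dots> = pmf (convolution_pmf G (convolution_power G \<mu> m) (convolution_power G \<mu> n)) \<one>"
    using walk_law_support finite_walk_law_support by (intro pmf_convolution[symmetric]) auto
  finally show ?thesis by (simp add: convolution_power_add[OF \<mu>(1)])
qed

text \<open>
The Markov operator of \<open>\<mu>\<close> acts by right translations, while the next law is a convolution. The two
agree because the laws are invariant under inversion.
\<close>
lemma walk_law_average:
  assumes "z \<in> carrier G"
  shows "(\<Sum>g\<in>set_pmf \<mu>. pmf \<mu> g * walk_law n (z \<otimes> g)) = walk_law (Suc n) z"
proof -
  have "walk_law (Suc n) z = walk_law (Suc n) (inv z)" by (rule walk_law_inv[OF assms, symmetric])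
  also have "\<dots> = (\<Sum>g\<in>set_pmf \<mu>. pmf \<mu> g * walk_law n (inv g \<otimes> inv z))"
    unfolding convolution_power_Suc_left[OF \<mu>(1)]
    using \<mu> walk_law_support assms by (intro pmf_convolution) auto
  also have "\<dots> = (\<Sum>g\<in>set_pmf \<mu>. pmf \<mu> g * walk_law n (z \<otimes> g))"
  proof (intro sum.cong refl)
    fix g assume "g \<in> set_pmf \<mu>"
    then have g: "g \<in> carrier G" using \<mu>(1) by blast
    have "inv g \<otimes> inv z = inv (z \<otimes> g)" using g assms by (simp add: inv_mult_group)
    then show "pmf \<mu> g * walk_law n (inv g \<otimes> inv z) = pmf \<mu> g * walk_law n (z \<otimes> g)"
      using walk_law_inv[of "z \<otimes> g"] g assms by simp
  qed
  finally show ?thesis ..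
qed

text \<open>
Two consecutive times are added because of parity. Return probabilities are controlled at even
times only, and \<open>\<parallel>\<mu>\<^sup>(\<^sup>k\<^sup>)\<parallel>\<^sup>2 - \<parallel>\<mu>\<^sup>(\<^sup>k\<^sup>+\<^sup>1\<^sup>)\<parallel>\<^sup>2\<close> is an energy for the two-step walk, whose support need not
generate the group. For the sum of two consecutive laws the one-step energy telescopes.
\<close>
definition "heat k = (\<lambda>x. walk_law k x + walk_law (Suc k) x)"

definition "heat_return k = return_prob (2 * k) + return_prob (2 * k + 1)"

lemma finitely_supported_heat: "finitely_supported G (heat k)"
  unfolding heat_def by (intro finitely_supported_add finitely_supported_walk_law)

lemma l2_inner_heat:
  "l2_inner G (heat k) (heat k)
     = return_prob (2 * k) + 2 * return_prob (2 * k + 1) + return_prob (2 * k + 2)"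
proof -
  have "l2_inner G (heat k) (heat k) = return_prob (k + k) + return_prob (k + Suc k)
      + (return_prob (Suc k + k) + return_prob (Suc k + Suc k))"
    unfolding heat_def by (simp only: l2_inner_add_left l2_inner_add_right
        finitely_supported_walk_law finitely_supported_add l2_inner_walk_law)
  moreover have "k + k = 2 * k" "k + Suc k = 2 * k + 1" "Suc k + k = 2 * k + 1" "Suc k + Suc k = 2 * k + 2"
    by simp_all
  ultimately show ?thesis by simp
qed

lemma l2_inner_heat_ge: "l2_inner G (heat k) (heat k) \<ge> heat_return k"
  unfolding l2_inner_heat heat_return_def by simp

text \<open>
The left-hand side is \<open>2 \<langle>f, (I - P) f\<rangle>\<close> with \<open>P\<close> the Markov operator of \<open>\<mu>\<close> and \<open>f\<close> the heat kernel at
time \<open>k\<close>, and \<open>P f\<close> is the heat kernel at time \<open>k + 1\<close>. All inner products are return probabilities.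
\<close>
lemma heat_energy:
  "(\<Sum>g\<in>set_pmf \<mu>. pmf \<mu> g * (displacement G (heat k) g)\<^sup>2)
     = 2 * (heat_return k - heat_return (Suc k))"
proof -
  let ?f = "heat k" and ?T = "set_pmf \<mu>"
  let ?A = "{x \<in> carrier G. ?f x \<noteq> 0}"
  have A: "finite ?A" using finitely_supported_heat[of k] by (simp add: finitely_supported_def)
  have ipA: "l2_inner G ?f h = (\<Sum>x\<in>?A. ?f x * h x)" for h
    using A by (intro l2_inner_finite_sum) auto
  have "(\<Sum>g\<in>?T. pmf \<mu> g * l2_inner G ?f (right_shift G g ?f))
      = (\<Sum>g\<in>?T. \<Sum>x\<in>?A. ?f x * (pmf \<mu> g * ?f (x \<otimes> g)))"
    unfolding ipA by (simp add: sum_distrib_left right_shift_def mult_ac)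
  also have "\<dots> = (\<Sum>x\<in>?A. ?f x * (\<Sum>g\<in>?T. pmf \<mu> g * ?f (x \<otimes> g)))"
    by (subst sum.swap) (simp add: sum_distrib_left)
  also have "\<dots> = (\<Sum>x\<in>?A. ?f x * heat (Suc k) x)"
    using walk_law_average[of _ k] walk_law_average[of _ "Suc k"]
    by (intro sum.cong refl) (simp add: heat_def algebra_simps sum.distrib)
  also have "\<dots> = l2_inner G ?f (heat (Suc k))" by (rule ipA[symmetric])
  also have "\<dots> = return_prob (k + Suc k) + return_prob (k + Suc (Suc k))
      + (return_prob (Suc k + Suc k) + return_prob (Suc k + Suc (Suc k)))"
    unfolding heat_def by (simp only: l2_inner_add_left l2_inner_add_right finitely_supported_walk_law finitely_supported_add l2_inner_walk_law)
  also have "\<dots> = return_prob (2 * k + 1) + 2 * return_prob (2 * k + 2) + return_prob (2 * k + 3)"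
  proof -
    have indices: "k + Suc k = 2 * k + 1" "k + Suc (Suc k) = 2 * k + 2" "Suc k + Suc k = 2 * k + 2"
      "Suc k + Suc (Suc k) = 2 * k + 3" by simp_all
    show ?thesis unfolding indices by linarith
  qed
  finally have cross: "(\<Sum>g\<in>?T. pmf \<mu> g * l2_inner G ?f (right_shift G g ?f))
      = return_prob (2 * k + 1) + 2 * return_prob (2 * k + 2) + return_prob (2 * k + 3)" .
  have "(\<Sum>g\<in>?T. pmf \<mu> g * (displacement G ?f g)\<^sup>2)
      = (\<Sum>g\<in>?T. 2 * l2_inner G ?f ?f * pmf \<mu> g - 2 * (pmf \<mu> g * l2_inner G ?f (right_shift G g ?f)))"
    using \<mu>(1) finitely_supported_heat by (intro sum.cong refl) (auto simp: displacement_sq subset_eq algebra_simps)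
  also have "\<dots> = 2 * l2_inner G ?f ?f * (\<Sum>g\<in>?T. pmf \<mu> g) - 2 * (\<Sum>g\<in>?T. pmf \<mu> g * l2_inner G ?f (right_shift G g ?f))"
    by (simp add: sum_subtractf sum_distrib_left)
  also have "(\<Sum>g\<in>?T. pmf \<mu> g) = 1"
    using \<mu>(3) by (intro sum_pmf_eq_1) auto
  finally show ?thesis
    unfolding cross l2_inner_heat heat_return_def by (simp add: numeral_3_eq_3)
qed

lemma heat_return_pos_bounds: "0 \<le> heat_return k" "heat_return k \<le> 2"
  using pmf_le_1[of "convolution_power G \<mu> (2 * k)" \<one>]
    pmf_le_1[of "convolution_power G \<mu> (2 * k + 1)" \<one>]
  by (auto simp: heat_return_def add_nonneg_nonneg simp del: pmf_le_1)

text \<open>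
If every step before \<open>n\<close> lost more than the fraction \<open>r\<close>, then the value at \<open>n\<close> would be at most
\<open>2 exp(- r n)\<close>.
\<close>
lemma exists_slow_step:
  assumes "heat_return n > 2 * exp (- (r * real n))"
  shows "\<exists>k<n. heat_return k - heat_return (Suc k) \<le> r * heat_return k"
proof (rule ccontr)
  assume "\<not> ?thesis"
  then have lt: "heat_return (Suc k) \<le> (1 - r) * heat_return k" if "k < n" for k
    using that by (force simp: algebra_simps)
  have "heat_return m \<le> 2 * exp (- (r * real m))" if "m \<le> n" for m
    using that
  proof (induction m)
    case 0
    then show ?case using heat_return_pos_bounds by simp
  next
    case (Suc m)
    have "heat_return (Suc m) \<le> (1 - r) * heat_return m" using lt Suc.prems by simp
    also have "\<dots> \<le> exp (- r) * heat_return m"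
      using exp_ge_add_one_self[of "- r"] heat_return_pos_bounds by (intro mult_right_mono) auto
    also have "\<dots> \<le> exp (- r) * (2 * exp (- (r * real m)))"
      using Suc by (intro mult_left_mono) auto
    also have "\<dots> = 2 * exp (- (r * real (Suc m)))"
      by (simp add: exp_add[symmetric] algebra_simps)
    finally show ?case .
  qed
  from this[of n] show False using assms by simp
qed

lemma sum_heat_le: "finite B \<Longrightarrow> (\<Sum>x\<in>B. heat k x) \<le> 2"
  unfolding heat_def sum.distrib
  using measure_pmf.prob_le_1[of "convolution_power G \<mu> k" B]
    measure_pmf.prob_le_1[of "convolution_power G \<mu> (Suc k)" B]
  by (simp add: measure_measure_pmf_finite del: convolution_power.simps)

lemma heat_nonneg: "heat k x \<ge> 0"
  by (simp add: heat_def)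

end

text \<open>
The function \<open>\<phi>\<close> is the normalisation of the positive part of \<open>f - t\<close> with
\<open>t = \<parallel>f\<parallel>\<^sub>2\<^sup>2 / (4 M)\<close>. This level is low enough to retain half of \<open>\<parallel>f\<parallel>\<^sub>2\<^sup>2\<close>, since the square of the
positive part is at least \<open>f\<^sup>2 - 2 t f\<close>, and high enough for Markov's inequality to bound the size of
the support. Cutting off is a contraction of the line, so it does not increase displacements.
\<close>
lemma truncation:
  assumes f: "finitely_supported G f" "\<And>x. f x \<ge> 0"
    and l1: "\<And>B. finite B \<Longrightarrow> B \<subseteq> carrier G \<Longrightarrow> (\<Sum>x\<in>B. f x) \<le> M" and M: "M > 0"
    and pos: "l2_inner G f f > 0"
  shows "\<exists>\<phi> U. unit_bump G U \<phi> \<and> real (card U) \<le> 4 * M\<^sup>2 / l2_inner G f f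
    \<and> (\<forall>g\<in>carrier G. displacement G \<phi> g \<le> sqrt (2 / l2_inner G f f) * displacement G f g)"
proof -
  define N where "N = l2_inner G f f"
  define t where "t = N / (4 * M)"
  define ft where "ft x = max 0 (f x - t)" for x
  define U where "U = {x \<in> carrier G. f x > t}"
  define A where "A = {x \<in> carrier G. f x \<noteq> 0}"
  have N: "N > 0" using pos by (simp add: N_def)
  have t: "t > 0" using N M by (simp add: t_def)
  have A: "finite A" "A \<subseteq> carrier G" using f by (auto simp: A_def finitely_supported_def)
  have UA: "U \<subseteq> A" using t by (auto simp: U_def A_def)
  have U: "finite U" "U \<subseteq> carrier G" using UA A finite_subset by auto
  have NA: "N = (\<Sum>x\<in>A. (f x)\<^sup>2)"
    unfolding N_def using A by (subst l2_inner_finite_sum[of A]) (auto simp: A_def power2_eq_square)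
  define q where "q = (\<Sum>x\<in>U. (ft x)\<^sup>2)"
  have "N / 2 \<le> N - 2 * t * (\<Sum>x\<in>A. f x)"
  proof -
    have "2 * t * (\<Sum>x\<in>A. f x) \<le> 2 * t * M" using l1 A t by (intro mult_left_mono) auto
    also have "\<dots> = N / 2" using M by (simp add: t_def)
    finally show ?thesis by simp
  qed
  also have "\<dots> = (\<Sum>x\<in>A. (f x)\<^sup>2 - 2 * t * f x)"
    by (simp add: NA sum_subtractf sum_distrib_left)
  also have "\<dots> \<le> (\<Sum>x\<in>A. (ft x)\<^sup>2)"
  proof (rule sum_mono)
    fix x
    show "(f x)\<^sup>2 - 2 * t * f x \<le> (ft x)\<^sup>2"
    proof (cases "f x > t")
      case True
      then show ?thesis by (simp add: ft_def power2_eq_square algebra_simps)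
    next
      case False
      have "f x * (f x - 2 * t) \<le> 0"
        using False f(2)[of x] t by (intro mult_nonneg_nonpos) auto
      then show ?thesis using False by (simp add: ft_def power2_eq_square algebra_simps)
    qed
  qed
  also have "\<dots> = q"
    unfolding q_def using A UA by (intro sum.mono_neutral_right) (auto simp: ft_def U_def)
  finally have q: "N / 2 \<le> q" .
  then have q0: "q > 0" using N by simp
  define \<phi> where "\<phi> x = ft x / sqrt q" for x
  have 1: "(\<Sum>x\<in>U. (\<phi> x)\<^sup>2) = 1"
    using q0 by (simp add: \<phi>_def power_divide sum_divide_distrib[symmetric] q_def[symmetric])
  have 2: "real (card U) \<le> 4 * M\<^sup>2 / N"
  proof -
    have "real (card U) * t = (\<Sum>x\<in>U. t)" by simp
    also have "\<dots> \<le> (\<Sum>x\<in>U. f x)" by (intro sum_mono) (auto simp: U_def)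
    also have "\<dots> \<le> M" using l1 U by blast
    finally show ?thesis using N M by (simp add: t_def field_simps power2_eq_square)
  qed
  have 3: "displacement G \<phi> g \<le> sqrt (2 / N) * displacement G f g" if g: "g \<in> carrier G" for g
  proof -
    define B where "B = A \<union> {x \<in> carrier G. right_shift G g f x \<noteq> 0}"
    have B: "finite B" "B \<subseteq> carrier G"
      using A finitely_supported_shift[OF g f(1)] by (auto simp: B_def finitely_supported_def)
    have out: "f x = 0 \<and> f (x \<otimes> g) = 0" if "x \<in> carrier G - B" for x
      using that by (auto simp: B_def A_def right_shift_def)
    have "l2_inner G (\<lambda>x. \<phi> x - right_shift G g \<phi> x) (\<lambda>x. \<phi> x - right_shift G g \<phi> x)
        = (\<Sum>x\<in>B. (\<phi> x - right_shift G g \<phi> x) * (\<phi> x - right_shift G g \<phi> x))"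
      by (rule l2_inner_finite_sum[OF B]) (use out t in \<open>auto simp: \<phi>_def ft_def right_shift_def\<close>)
    also have "\<dots> = (\<Sum>x\<in>B. (ft x - ft (x \<otimes> g))\<^sup>2) / q"
      unfolding sum_divide_distrib using q0
      by (intro sum.cong refl) (simp add: \<phi>_def right_shift_def power2_eq_square diff_divide_distrib[symmetric])
    also have "\<dots> \<le> (\<Sum>x\<in>B. (f x - f (x \<otimes> g))\<^sup>2) / q"
      using q0 by (intro divide_right_mono sum_mono abs_le_square_iff[THEN iffD1]) (auto simp: ft_def)
    also have "\<dots> \<le> (\<Sum>x\<in>B. (f x - f (x \<otimes> g))\<^sup>2) / (N / 2)"
      using q N by (intro divide_left_mono sum_nonneg) auto
    also have "\<dots> = 2 / N * l2_inner G (\<lambda>x. f x - right_shift G g f x) (\<lambda>x. f x - right_shift G g f x)"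
      using out by (subst l2_inner_finite_sum[OF B]) (auto simp: right_shift_def power2_eq_square)
    finally show ?thesis
      unfolding displacement_def real_sqrt_mult[symmetric] by (rule real_sqrt_le_mono)
  qed
  have 4: "\<forall>x. \<phi> x \<ge> 0" using q0 by (simp add: \<phi>_def ft_def)
  have 5: "\<forall>x\<in>carrier G - U. \<phi> x = 0" by (auto simp: \<phi>_def ft_def U_def)
  show ?thesis
    using U 1 2 3 4 5 unfolding N_def unit_bump_def by blast
qed

text \<open>
The choice \<open>n = L\<^sup>3\<close> turns \<open>exp(- (c\<^sub>2 n)\<^sup>1\<^sup>/\<^sup>3)\<close> into \<open>exp(- O(L))\<close>, and a slow step with
\<open>r = K / L\<^sup>2\<close> exists because \<open>r n = K L\<close>. The heat kernel at that step has squared norm at least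
\<open>exp(- K L)\<close> and relative energy \<open>O(L\<^sup>-\<^sup>2)\<close>. Its truncation therefore has support of size
\<open>exp(O(L))\<close> and is moved by \<open>O(1 / L)\<close> under each of the finitely many steps of \<open>\<mu>\<close>, hence under each
element of \<open>S\<close>.
\<close>
lemma almost_invariant_functions:
  assumes \<mu>: "set_pmf \<mu> \<subseteq> carrier G" "symmetric_pmf G \<mu>" "finite (set_pmf \<mu>)"
      "generate G (set_pmf \<mu>) = carrier G"
    and c: "c1 > 0" "c2 > 0"
    and ret: "\<And>n::nat. n \<ge> 1 \<Longrightarrow>
      pmf (convolution_power G \<mu> (2 * n)) \<one> \<ge> c1 * exp (- ((c2 * real n) powr (1 / 3)))"
    and S: "finite S" "S \<subseteq> carrier G" "generate G S = carrier G"
  shows "\<exists>C>0. \<forall>L::nat. L \<ge> 1 \<longrightarrow> (\<exists>\<phi> U. unit_bump G U \<phi> \<and>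
    real (card U) \<le> exp (C * real L) \<and>
    (\<forall>g\<in>carrier G. displacement G \<phi> g \<le> C / real L * real (word_length G S g)))"
proof -
  define m where "m = Min (pmf \<mu> ` set_pmf \<mu>)"
  have m: "m > 0" "\<And>g. g \<in> set_pmf \<mu> \<Longrightarrow> m \<le> pmf \<mu> g"
    unfolding m_def using \<mu>(3) set_pmf_not_empty[of \<mu>] by (auto simp: pmf_positive)
  define a where "a = c2 powr (1 / 3)"
  \<comment> \<open>The logarithm absorbs \<open>c1\<close> and the factor \<open>2\<close> of \<open>exists_slow_step\<close>, and the summand
    \<open>1\<close> makes its hypothesis strict. The \<open>16\<close> in \<open>C\<close> absorbs the factor \<open>4 * 2\<^sup>2\<close> of
    \<open>truncation\<close>, where \<open>2\<close> is the \<open>\<ell>\<^sup>1\<close>-norm of the heat kernel.\<close>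
  define K where "K = a + \<bar>ln (2 / c1)\<bar> + 1"
  have a: "a \<ge> 0" by (simp add: a_def)
  have K: "K > 0" using a by (simp add: K_def)
  define w where "w = Max (insert 0 (word_length G (set_pmf \<mu>) ` S))"
  have w: "word_length G (set_pmf \<mu>) s \<le> w" if "s \<in> S" for s
    unfolding w_def using S(1) that by (intro Max_ge) auto
  define D where "D = 2 * sqrt (K / m)"
  have D: "D \<ge> 0" using K m by (simp add: D_def)
  define C where "C = max (K + 16) (D * real w)"
  have C: "C > 0" "K + 16 \<le> C" "D * real w \<le> C" using K by (auto simp: C_def)
  have "\<exists>\<phi> U. unit_bump G U \<phi> \<and> real (card U) \<le> exp (C * real L) \<and>
    (\<forall>g\<in>carrier G. displacement G \<phi> g \<le> C / real L * real (word_length G S g))"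
    if L: "L \<ge> 1" for L :: nat
  proof -
    let ?h = "heat \<mu>" and ?s = "heat_return \<mu>"
    have ret': "pmf (convolution_power G \<mu> (2 * k)) \<one> > 2 * exp (- K * real L)"
      if "k \<ge> 1" "k \<le> L ^ 3" for k
    proof -
      have "(c2 * real k) powr (1 / 3) \<le> (c2 * real L ^ 3) powr (1 / 3)"
        using that c by (intro powr_mono2 mult_left_mono) (auto simp flip: of_nat_power)
      also have "\<dots> = a * (real L ^ 3) powr (1 / 3)"
        using c L by (simp add: powr_mult a_def)
      also have "(real L ^ 3) powr (1 / 3) = real L"
        using L powr_powr[of "real L" 3 "1 / 3"] powr_numeral[of "real L" "num.Bit1 num.One"] by simp
      finally have 1: "(c2 * real k) powr (1 / 3) \<le> a * real L" .
      have "ln (2 / c1) \<le> \<bar>ln (2 / c1)\<bar> * real L"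
        using L mult_left_mono[of 1 "real L" "\<bar>ln (2 / c1)\<bar>"] by linarith
      then have 2: "ln (2 / c1) - K * real L < - (a * real L)"
        using L by (simp add: K_def algebra_simps)
      have "2 * exp (- K * real L) = c1 * (exp (ln (2 / c1)) * exp (- K * real L))"
        using c by simp
      also have "\<dots> = c1 * exp (ln (2 / c1) - K * real L)"
        by (simp only: exp_add[symmetric]) simp
      also have "\<dots> < c1 * exp (- ((c2 * real k) powr (1 / 3)))"
        using c 1 2 by simp
      finally show ?thesis using ret[OF that(1)] by simp
    qed
    define r where "r = K / (real L)\<^sup>2"
    have rn: "r * real (L ^ 3) = K * real L"
      using L by (simp add: r_def power2_eq_square power3_eq_cube)
    have "?s (L ^ 3) > 2 * exp (- (r * real (L ^ 3)))"
      unfolding rn using ret'[of "L ^ 3"] L pmf_nonneg[of "convolution_power G \<mu> (2 * L ^ 3 + 1)" \<one>]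
      by (simp add: heat_return_def[OF \<mu>(1-3)] add_strict_increasing2 del: pmf_nonneg)
    from exists_slow_step[OF \<mu>(1-3) this] obtain k where k: "k < L ^ 3"
        "?s k - ?s (Suc k) \<le> r * ?s k" by blast
    let ?N = "l2_inner G (?h k) (?h k)"
    have sN: "?s k \<le> ?N" by (rule l2_inner_heat_ge[OF \<mu>(1-3)])
    have "exp (- K * real L) \<le> pmf (convolution_power G \<mu> (2 * k)) \<one>"
    proof (cases "k = 0")
      case True
      then show ?thesis using K by simp
    next
      case False
      then show ?thesis using ret'[of k] k(1) exp_gt_zero[of "- K * real L"] by linarith
    qed
    also have "\<dots> \<le> ?s k" by (simp add: heat_return_def[OF \<mu>(1-3)])
    finally have Nlow: "exp (- K * real L) \<le> ?N" using sN by simp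
    then have N: "?N > 0" using exp_gt_zero less_le_trans by blast
    obtain \<phi> U where \<phi>: "unit_bump G U \<phi>" "real (card U) \<le> 4 * 2\<^sup>2 / ?N"
        "\<forall>g\<in>carrier G. displacement G \<phi> g \<le> sqrt (2 / ?N) * displacement G (?h k) g"
      using truncation[OF finitely_supported_heat[OF \<mu>(1-3), of k] heat_nonneg[OF \<mu>(1-3)]
          sum_heat_le[OF \<mu>(1-3)] _ N] by auto
    have fin\<phi>: "finitely_supported G \<phi>"
      by (rule finitely_supported_bump[OF \<phi>(1)])
    have "displacement G \<phi> g \<le> D / real L" if g: "g \<in> set_pmf \<mu>" for g
    proof -
      have "m * (displacement G (?h k) g)\<^sup>2 \<le> pmf \<mu> g * (displacement G (?h k) g)\<^sup>2"
        using m(2)[OF g] by (intro mult_right_mono) auto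
      also have "\<dots> \<le> (\<Sum>g\<in>set_pmf \<mu>. pmf \<mu> g * (displacement G (?h k) g)\<^sup>2)"
        using g \<mu>(3) by (intro member_le_sum) auto
      also have "\<dots> = 2 * (?s k - ?s (Suc k))" by (rule heat_energy[OF \<mu>(1-3)])
      also have "\<dots> \<le> 2 * (r * ?N)"
      proof -
        have "r * ?s k \<le> r * ?N" using sN K by (intro mult_left_mono) (auto simp: r_def)
        with k(2) have "?s k - ?s (Suc k) \<le> r * ?N" by (rule order_trans)
        then show ?thesis by simp
      qed
      finally have "(displacement G (?h k) g)\<^sup>2 \<le> 2 * r * ?N / m"
        using m(1) by (simp add: field_simps)
      then have "2 / ?N * (displacement G (?h k) g)\<^sup>2 \<le> 2 / ?N * (2 * r * ?N / m)"
        using N by (intro mult_left_mono) auto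
      also have "\<dots> = (D / real L)\<^sup>2"
        using N K m by (simp add: r_def D_def power_divide)
      finally have "(sqrt (2 / ?N) * displacement G (?h k) g)\<^sup>2 \<le> (D / real L)\<^sup>2"
        using N by (simp add: power_mult_distrib)
      then have "sqrt (2 / ?N) * displacement G (?h k) g \<le> D / real L"
        by (rule power2_le_imp_le) (use D in simp)
      then show ?thesis using \<phi>(3) g \<mu>(1) by fastforce
    qed
    then have "displacement G \<phi> s \<le> D / real L * real (word_length G (set_pmf \<mu>) s)"
      if "s \<in> S" for s
      using displacement_le_word_length[OF \<mu>(1,4) fin\<phi>] that S(2) by blast
    moreover have "D / real L * real (word_length G (set_pmf \<mu>) s) \<le> C / real L" if "s \<in> S" for s
    proof -
      have "D * real (word_length G (set_pmf \<mu>) s) \<le> D * real w"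
        using w[OF that] D by (intro mult_left_mono) auto
      also have "\<dots> \<le> C" by (rule C(3))
      finally show ?thesis using L by (simp add: divide_right_mono)
    qed
    ultimately have "displacement G \<phi> s \<le> C / real L" if "s \<in> S" for s
      using that by (meson order_trans)
    then have disp: "\<forall>g\<in>carrier G. displacement G \<phi> g \<le> C / real L * real (word_length G S g)"
      using displacement_le_word_length[OF S(2,3) fin\<phi>] by blast
    have "real (card U) \<le> 16 / ?N" using \<phi>(2) by simp
    also have "\<dots> \<le> 16 / exp (- K * real L)"
      using Nlow N by (intro divide_left_mono) auto
    also have "\<dots> = 16 * exp (K * real L)" by (simp add: exp_minus field_simps)
    also have "\<dots> \<le> exp (16 * real L) * exp (K * real L)"
    proof -
      have "1 + 16 * real L \<le> exp (16 * real L)" by (rule exp_ge_add_one_self)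
      then have "16 \<le> exp (16 * real L)" using L by linarith
      then show ?thesis by (intro mult_right_mono) auto
    qed
    also have "\<dots> = exp ((K + 16) * real L)" by (simp add: exp_add[symmetric] algebra_simps)
    also have "\<dots> \<le> exp (C * real L)" using C(2) by (simp add: mult_right_mono)
    finally show ?thesis using \<phi>(1) disp by blast
  qed
  then show ?thesis using C(1) by blast
qed

end

section \<open>Steps with finite first moment\<close>

lemma integrable_pmf_if_summable:
  fixes f :: "'a \<Rightarrow> real"
  assumes "set_pmf M \<subseteq> A" "(\<lambda>x. f x * pmf M x) summable_on A"
  shows "integrable (measure_pmf M) f"
proof -
  have "(\<lambda>x. f x * pmf M x) abs_summable_on A"
    using assms(2)
    by (intro iffD1[OF abs_summable_equivalent] iffD1[OF summable_on_iff_abs_summable_on_real])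
  also have "?this \<longleftrightarrow> (\<lambda>x. pmf M x * f x) abs_summable_on UNIV"
    using assms(1) by (intro abs_summable_on_cong_neutral) (auto simp: set_pmf_eq)
  finally show ?thesis
    unfolding measure_pmf_eq_density abs_summable_on_def
    by (subst integrable_density) auto
qed

lemma dyadic_between:
  fixes x :: real
  assumes "x \<ge> 1"
  shows "\<exists>j. x \<le> 2 ^ j \<and> 2 ^ j \<le> 2 * x"
proof -
  define k where "k = nat \<lfloor>x\<rfloor>"
  have k: "k \<ge> 1" "real k \<le> x" "x < real k + 1"
    using assms by (auto simp: k_def le_nat_floor)
  obtain n where n: "2 ^ n \<le> k" "k < 2 ^ (n + 1)"
    using ex_power_ivl1[of 2 k] k(1) by auto
  have "real k + 1 \<le> 2 ^ (n + 1)"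
    using n(2) by (metis Suc_leI of_nat_Suc of_nat_le_iff of_nat_numeral of_nat_power add.commute)
  then have "x \<le> 2 ^ (n + 1)" using k(3) by linarith
  moreover have "(2::real) ^ n \<le> real k"
    using n(1) by (metis of_nat_le_iff of_nat_numeral of_nat_power)
  then have "(2::real) ^ n \<le> x" using k(2) by (rule order_trans)
  then have "2 ^ (n + 1) \<le> 2 * x" by simp
  ultimately have "x \<le> 2 ^ (n + 1)" "2 ^ (n + 1) \<le> 2 * x" .
  then show ?thesis by blast
qed

text \<open>
As \<open>min 1 (u\<^sup>2 / 2) \<le> u\<close>, the integrand multiplied by \<open>L\<close> is dominated by \<open>C X\<close>, and it is at most
\<open>C\<^sup>2 X\<^sup>2 / (2 L)\<close>, which tends to \<open>0\<close> pointwise. It is this gain over the bound \<open>O(1 / L)\<close> that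
the argument lives on.
\<close>
lemma truncated_second_moment_small:
  fixes X :: "'c \<Rightarrow> real"
  assumes "integrable (measure_pmf M) X" "\<And>x. X x \<ge> 0" "C > 0"
  shows "(\<lambda>L. real L * measure_pmf.expectation M (\<lambda>x. min 1 ((C / real L * X x)\<^sup>2 / 2)))
    \<longlonglongrightarrow> 0"
proof -
  have min_le: "min 1 (u\<^sup>2 / 2) \<le> u" if u: "u \<ge> 0" for u :: real
  proof (cases "u \<ge> 1")
    case False
    then have "u * u \<le> u * 1" using u by (intro mult_left_mono) auto
    then show ?thesis using u by (simp add: min.coboundedI2 power2_eq_square)
  qed (simp add: min.coboundedI1)
  have "(\<lambda>L. measure_pmf.expectation M (\<lambda>x. real L * min 1 ((C / real L * X x)\<^sup>2 / 2)))
      \<longlonglongrightarrow> measure_pmf.expectation M (\<lambda>x. 0)"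
  proof (rule integral_dominated_convergence[where w = "\<lambda>x. C * X x"])
    show "integrable (measure_pmf M) (\<lambda>x. C * X x)"
      using assms(1) by simp
    show "AE x in measure_pmf M. (\<lambda>L. real L * min 1 ((C / real L * X x)\<^sup>2 / 2)) \<longlonglongrightarrow> 0"
    proof (rule AE_I2)
      fix x
      show "(\<lambda>L. real L * min 1 ((C / real L * X x)\<^sup>2 / 2)) \<longlonglongrightarrow> 0"
      proof (rule tendsto_sandwich[OF _ _ tendsto_const])
        show "(\<lambda>L. (C * X x)\<^sup>2 / 2 / real L) \<longlonglongrightarrow> 0"
          by (rule lim_const_over_n)
        show "\<forall>\<^sub>F L in sequentially. real L * min 1 ((C / real L * X x)\<^sup>2 / 2)
            \<le> (C * X x)\<^sup>2 / 2 / real L"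
        proof (rule eventually_sequentiallyI[of 1])
          fix L :: nat assume L: "1 \<le> L"
          have "real L * min 1 ((C / real L * X x)\<^sup>2 / 2) \<le> real L * ((C / real L * X x)\<^sup>2 / 2)"
            by (intro mult_left_mono) auto
          also have "\<dots> = (C * X x)\<^sup>2 / 2 / real L"
            using L by (simp add: power2_eq_square field_simps)
          finally show "real L * min 1 ((C / real L * X x)\<^sup>2 / 2) \<le> (C * X x)\<^sup>2 / 2 / real L" .
        qed
      qed auto
    qed
    fix L :: nat
    show "AE x in measure_pmf M. norm (real L * min 1 ((C / real L * X x)\<^sup>2 / 2)) \<le> C * X x"
    proof (rule AE_I2)
      fix x
      let ?u = "C / real L * X x"
      have u: "?u \<ge> 0" using assms(2)[of x] assms(3) by simp
      have "min 1 (?u\<^sup>2 / 2) \<le> ?u" using u by (rule min_le)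
      then have "real L * min 1 (?u\<^sup>2 / 2) \<le> real L * ?u"
        by (intro mult_left_mono) auto
      also have "\<dots> \<le> C * X x" using assms(2)[of x] assms(3) by simp
      finally show "norm (real L * min 1 (?u\<^sup>2 / 2)) \<le> C * X x" by simp
    qed
  qed auto
  then show ?thesis by simp
qed

context group begin

text \<open>
Choose the time \<open>n = 2\<^sup>j\<close> between \<open>2 C L / \<epsilon>\<close> and twice this number. The lower bound makes
\<open>|U\<inverse> U| \<le> exp(2 C L) \<le> exp(\<epsilon> n)\<close>. The upper bound makes the loss \<open>n \<theta>\<close> in the
probability at most \<open>\<epsilon>\<close> once \<open>L \<theta> \<le> \<epsilon>\<^sup>2 / (4 C)\<close>, which holds for large \<open>L\<close> because
\<open>\<theta> = o(1 / L)\<close>.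
\<close>
lemma subexponential_concentration:
  assumes \<eta>: "set_pmf \<eta> \<subseteq> carrier G" "symmetric_pmf G \<eta>"
    and moment: "integrable (measure_pmf \<eta>) (\<lambda>g. real (word_length G S g))"
    and C: "C > 0"
    and ex: "\<And>L::nat. L \<ge> 1 \<Longrightarrow> \<exists>\<phi> U. unit_bump G U \<phi> \<and>
      real (card U) \<le> exp (C * real L) \<and>
      (\<forall>g\<in>carrier G. displacement G \<phi> g \<le> C / real L * real (word_length G S g))"
    and \<epsilon>: "\<epsilon> > 0"
  shows "\<exists>n\<ge>n0. \<exists>V. finite V \<and> V \<subseteq> carrier G \<and> real (card V) \<le> exp (\<epsilon> * real n) \<and>
    measure (measure_pmf (convolution_power G \<eta> n)) V \<ge> 1 - \<epsilon>"
proof -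
  define X where "X g = real (word_length G S g)" for g
  define lam where "lam L = measure_pmf.expectation \<eta> (\<lambda>x. min 1 ((C / real L * X x)\<^sup>2 / 2))" for L :: nat
  have "(\<lambda>L. real L * lam L) \<longlonglongrightarrow> 0"
    unfolding lam_def using moment C
    by (intro truncated_second_moment_small) (auto simp: X_def[abs_def])
  then have "\<forall>\<^sub>F L in sequentially. real L * lam L < \<epsilon>\<^sup>2 / (4 * C)"
    by (rule order_tendstoD(2)) (use C \<epsilon> in simp)
  moreover have "\<forall>\<^sub>F L in sequentially. L \<ge> nat \<lceil>(real n0 + 1) * \<epsilon> / (2 * C)\<rceil> + 1"
    by (rule eventually_ge_at_top)
  ultimately have "\<forall>\<^sub>F L in sequentially. real L * lam L < \<epsilon>\<^sup>2 / (4 * C) \<and>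
      L \<ge> nat \<lceil>(real n0 + 1) * \<epsilon> / (2 * C)\<rceil> + 1"
    by (rule eventually_conj)
  then obtain L where L: "real L * lam L < \<epsilon>\<^sup>2 / (4 * C)" "L \<ge> nat \<lceil>(real n0 + 1) * \<epsilon> / (2 * C)\<rceil> + 1"
    using eventually_happens'[OF sequentially_bot] by blast
  \<comment> \<open>The least time for which \<open>exp(2 C L)\<close>, the bound for \<open>|U\<inverse> U|\<close>, is at most \<open>exp(\<epsilon> n)\<close>.\<close>
  define x where "x = 2 * C * real L / \<epsilon>"
  have "(real n0 + 1) * \<epsilon> / (2 * C) \<le> real L"
    using L(2) by linarith
  then have x: "real n0 + 1 \<le> x"
    using C \<epsilon> by (simp add: x_def field_simps)
  then obtain j where j: "x \<le> 2 ^ j" "2 ^ j \<le> 2 * x"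
    using dyadic_between[of x] by auto
  have L1: "L \<ge> 1" using L(2) by simp
  from ex[OF L1] obtain \<phi> U where \<phi>: "unit_bump G U \<phi>" "real (card U) \<le> exp (C * real L)"
      "\<And>g. g \<in> carrier G \<Longrightarrow> displacement G \<phi> g \<le> C / real L * X g"
    unfolding X_def by metis
  let ?o = "\<lambda>y. \<Sum>x\<in>U. \<phi> x * \<phi> (x \<otimes> y)"
  let ?V = "(\<lambda>(x, z). inv x \<otimes> z) ` (U \<times> U)"
  have o: "0 \<le> 1 - ?o y" "1 - ?o y \<le> min 1 ((C / real L * X y)\<^sup>2 / 2)" if y: "y \<in> carrier G" for y
  proof -
    show "0 \<le> 1 - ?o y" using overlap_le_one[OF \<phi>(1) y] by simp
    have "1 - ?o y = (displacement G \<phi> y)\<^sup>2 / 2"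
      by (rule overlap_eq_displacement[OF \<phi>(1) y])
    also have "\<dots> \<le> (C / real L * X y)\<^sup>2 / 2"
      using \<phi>(3)[OF y] displacement_nonneg by (intro divide_right_mono power_mono) auto
    finally show "1 - ?o y \<le> min 1 ((C / real L * X y)\<^sup>2 / 2)"
      using overlap_nonneg[OF \<phi>(1), of y] by simp
  qed
  have "measure_pmf.expectation \<eta> (\<lambda>y. 1 - ?o y) \<le> lam L"
    unfolding lam_def
  proof (rule expectation_mono_bounded[where A = 1 and B = 1])
    fix y assume "y \<in> set_pmf \<eta>"
    then have y: "y \<in> carrier G" using \<eta>(1) by blast
    show "1 - ?o y \<le> min 1 ((C / real L * X y)\<^sup>2 / 2)" by (rule o[OF y])
    then show "\<bar>1 - ?o y\<bar> \<le> 1" using o(1)[OF y] by simp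
  qed simp
  then have "1 - real (2 ^ j) * lam L \<le> measure (measure_pmf (convolution_power G \<eta> (2 ^ j))) ?V"
    by (rule prob_quotient_set_ge[OF \<phi>(1) \<eta>])
  moreover have "real (2 ^ j) * lam L \<le> \<epsilon>"
  proof -
    have lam0: "lam L \<ge> 0" unfolding lam_def by (intro Bochner_Integration.integral_nonneg) simp
    have "real (2 ^ j) * lam L \<le> 2 * x * lam L"
      using j(2) lam0 by (intro mult_right_mono) auto
    also have "\<dots> = 4 * C / \<epsilon> * (real L * lam L)" by (simp add: x_def)
    also have "\<dots> \<le> 4 * C / \<epsilon> * (\<epsilon>\<^sup>2 / (4 * C))"
      using L(1) C \<epsilon> by (intro mult_left_mono) auto
    also have "\<dots> = \<epsilon>" using C \<epsilon> by (simp add: power2_eq_square)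
    finally show ?thesis .
  qed
  ultimately have "1 - \<epsilon> \<le> measure (measure_pmf (convolution_power G \<eta> (2 ^ j))) ?V" by linarith
  moreover have "real (card ?V) \<le> exp (\<epsilon> * real (2 ^ j))"
  proof -
    have "card ?V \<le> card U * card U"
      using card_image_le[of "U \<times> U"] \<phi>(1) by (simp add: card_cartesian_product unit_bump_def)
    then have "real (card ?V) \<le> real (card U) * real (card U)"
      by (metis of_nat_le_iff of_nat_mult)
    also have "\<dots> \<le> exp (C * real L) * exp (C * real L)"
      using \<phi>(2) by (intro mult_mono) auto
    also have "\<dots> = exp (\<epsilon> * x)"
      using \<epsilon> by (simp add: exp_add[symmetric] x_def)
    also have "\<dots> \<le> exp (\<epsilon> * real (2 ^ j))"
      using j(1) \<epsilon> by simp
    finally show ?thesis .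
  qed
  moreover have "n0 \<le> 2 ^ j"
  proof -
    have "real n0 \<le> 2 ^ j" using j(1) x by linarith
    then show ?thesis by (metis of_nat_le_iff of_nat_numeral of_nat_power)
  qed
  moreover have "finite ?V" "?V \<subseteq> carrier G"
    using \<phi>(1) by (auto simp: unit_bump_def)
  ultimately show ?thesis by blast
qed

end

section \<open>The Liouville property\<close>

theorem corollary1p3:
  fixes G :: "('a, 'b) monoid_scheme" and S :: "'a set"
  assumes "group G"
    and "infinite (carrier G)"
    and "finite S" and "generating_set G S"
    and "\<exists>\<mu>. pmf_on_group G \<mu> \<and> symmetric_pmf G \<mu> \<and>
           finite (set_pmf \<mu>) \<and> generating_set G (set_pmf \<mu>) \<and>
           (\<exists>c1 c2 :: real. c1 > 0 \<and> c2 > 0 \<and>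
             (\<forall>n :: nat. n \<ge> 1 \<longrightarrow>
               pmf (convolution_power G \<mu> (2 * n)) \<one>\<^bsub>G\<^esub>
                 \<ge> c1 * exp (- ((c2 * real n) powr (1 / 3)))))"
  shows "\<forall>\<eta>. pmf_on_group G \<eta> \<and> symmetric_pmf G \<eta> \<and>
           generating_set G (set_pmf \<eta>) \<and> finite_first_moment G S \<eta> \<longrightarrow>
           liouville G \<eta>"
proof (intro allI impI)
  fix \<eta> :: "'a pmf"
  assume \<eta>: "pmf_on_group G \<eta> \<and> symmetric_pmf G \<eta> \<and>
           generating_set G (set_pmf \<eta>) \<and> finite_first_moment G S \<eta>"
  interpret group G by fact
  from assms(5) obtain \<mu> c1 c2 where \<mu>: "set_pmf \<mu> \<subseteq> carrier G" "symmetric_pmf G \<mu>"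
      "finite (set_pmf \<mu>)" "generate G (set_pmf \<mu>) = carrier G"
    and c: "c1 > 0" "c2 > 0"
    and ret: "\<And>n::nat. n \<ge> 1 \<Longrightarrow>
      pmf (convolution_power G \<mu> (2 * n)) \<one>\<^bsub>G\<^esub> \<ge> c1 * exp (- ((c2 * real n) powr (1 / 3)))"
    unfolding pmf_on_group_def generating_set_def by blast
  have S: "S \<subseteq> carrier G" "generate G S = carrier G"
    using assms(4) by (auto simp: generating_set_def)
  have supp: "set_pmf \<eta> \<subseteq> carrier G" "symmetric_pmf G \<eta>" "generate G (set_pmf \<eta>) = carrier G"
    using \<eta> by (auto simp: pmf_on_group_def generating_set_def)
  have moment: "integrable (measure_pmf \<eta>) (\<lambda>g. real (word_length G S g))"
    using \<eta> integrable_pmf_if_summable[OF supp(1)] by (simp add: finite_first_moment_def)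
  obtain C where "C > 0" and "\<And>L::nat. L \<ge> 1 \<Longrightarrow> \<exists>\<phi> U. unit_bump G U \<phi> \<and>
      real (card U) \<le> exp (C * real L) \<and>
      (\<forall>g\<in>carrier G. displacement G \<phi> g \<le> C / real L * real (word_length G S g))"
    using almost_invariant_functions[OF \<mu> c ret assms(3) S] by blast
  from subexponential_concentration[OF supp(1,2) moment this]
  show "liouville G \<eta>"
    by (intro liouville_if_subexponential_concentration[OF supp(1,3)])
qed

end
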